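(* Consider the generalized linear model with natural link and the $\ell_1$-type penalized maximum likelihood estimator $\hat{\boldsymbol\beta}_\lambda$ described in the context, with tuning parameter $\lambda_n=n^{(\gamma_0-2)/2}\lambda$, where $\lambda>0$ is fixed and $\gamma_0\in(1,2)$. Assume conditions (C1), (C2) on the regressors and (P1)–(P5) on the penalty, as listed in the context. Then $\hat{\boldsymbol\beta}_\lambda$ has variable selection consistency: with $\hat{\mathcal J}^{(2)}=\{j:\hat\beta_{\lambda,j}\neq0\}$ and $\mathcal J^{(2)}=\{j:\beta^*_j\ne0\}$, $$\mathrm P\big(\hat{\mathcal J}^{(2)}=\mathcal J^{(2)}\big)\to1\quad\text{as } n\to\infty.$$
   Context: Model. Let $f(\boldsymbol y;\boldsymbol\theta)=\exp\{\boldsymbol y^{\rm T}\boldsymbol\theta-a(\boldsymbol\theta)+b(\boldsymbol y)\}$ be a natural exponential family of densities on $\mathbb R^r$ with respect to a $\sigma$-finite measure, where $\boldsymbol\theta\in\Theta\subset\mathbb R^r$ and $\Theta$ is the natural parameter space (those $\boldsymbol\theta$ for which the normalizing integral of $\exp\{\boldsymbol y^{\rm T}\boldsymbol\theta+b(\boldsymbol y)\}$ is positive and finite); $\Theta^\circ$ is its interior. It is assumed that $\mathrm V[\boldsymbol y]=a''(\boldsymbol\theta)$ is positive definite (primes denote gradient and Hessian). The data are $(\boldsymbol y_i,\boldsymbol X_i)$, $i=1,\dots,n$, with $\boldsymbol y_i$ independent $r$-dimensional random vectors and $\boldsymbol X_i\in\mathcal X\subset\mathbb R^{r\times p}$ known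 constant matrices; $\boldsymbol y_i$ has density $f(\cdot;\boldsymbol X_i\boldsymbol\beta^* )$, where $\boldsymbol\beta^*\in\mathcal B$ is the true parameter and $\mathcal B\subset\mathbb R^p$ is an open convex set; $p$ and $r$ are fixed and $n\to\infty$. The log-likelihood of $\boldsymbol y_i$ is $g_i(\boldsymbol\beta)=\boldsymbol y_i^{\rm T}\boldsymbol X_i\boldsymbol\beta-a(\boldsymbol X_i\boldsymbol\beta)+b(\boldsymbol y_i)$. Conditions on regressors. (C1) $\mathcal X$ is compact and $\boldsymbol X\boldsymbol\beta\in\Theta^\circ$ for all $\boldsymbol X\in\mathcal X$, $\boldsymbol\beta\in\mathcal B$. (C2) There exists an invariant distribution $\mu$ on $\mathcal X$; in particular, $n^{-1}\sum_{i=1}^n\boldsymbol X_i^{\rm T}a''(\boldsymbol X_i\boldsymbol\beta)\boldsymbol X_i$ converges to a positive-definite matrix $\boldsymbol J(\boldsymbol\beta)=\int_{\mathcal X}\boldsymbol X^{\rm T}a''(\boldsymbol X\boldsymbol\beta)\boldsymbol X\,\mu(\mathrm d\boldsymbol X)$. Estimator. $\hat{\boldsymbol\beta}_\lambda=\mathrm{argmin}_{\boldsymbol\beta\in\mathcal B}\{-\sum_{i=1}^n g_i(\boldsymbol\beta)+n\sum_{j=1}^p\eta_{\lambda_n}(\beta_j)\}$, where $\eta_{\lambda_n}$ is a (not necessarily convex) penalty function. Conditions on the penalty. (P1) $\eta_{\lambda_n}(\beta)$ is non-differentiable only at the origin, symmetric about $\beta=0$, and monotone non-decreasing in $|\beta|$.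 (P2) $\lim_{\beta\to0}\eta_{\lambda_n}(\beta)/|\beta|=\lambda_n$ (this is understood to imply $\eta_{\lambda_n}(0)=0$ and $\lim_{\beta\to0}\eta'_{\lambda_n}(\beta)/\mathrm{sgn}(\beta)=\lambda_n$). (P3) $\lim_{n\to\infty}\eta_{\lambda_n}(\beta)=0$ for any $\beta$. (P4) There exists $\tau>0$ such that $\eta'_{\lambda_n}(\beta)=0$ for any $|\beta|\ge\tau\lambda_n$. (P5) $\lim_{n\to\infty}\eta''_{\lambda_n}(\beta)=0$ for any $\beta\ne0$.
   Formalization: Condition (P2) is strengthened: η_{λ_n}(t_n)/|t_n| must be asymptotic to λ_n for all nonzero t_n = O(n^{-1/2}). Read only for each fixed n, (P1)–(P5) allow a penalty with slope λ_n just on |t|<e^{-n}, constant beyond 2e^{-n}, for which the claim fails. SCAD and MCP satisfy it. *)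

theory Defs
  imports "HOL-Probability.Probability" "HOL-Library.Landau_Symbols"
begin

section \<open>Gradient, Hessian, positive definiteness\<close>

definition gradient :: "(real ^ 'n \<Rightarrow> real) \<Rightarrow> real ^ 'n \<Rightarrow> real ^ 'n" where
  "gradient f x = (\<chi> i. frechet_derivative f (at x) (axis i 1))"

definition hessian :: "(real ^ 'n \<Rightarrow> real) \<Rightarrow> real ^ 'n \<Rightarrow> real ^ 'n ^ 'n" where
  "hessian f x = matrix (frechet_derivative (gradient f) (at x))"

definition positive_definite :: "real ^ 'n ^ 'n \<Rightarrow> bool" where
  "positive_definite A \<longleftrightarrow> transpose A = A \<and> (\<forall>v. v \<noteq> 0 \<longrightarrow> v \<bullet> (A *v v) > 0)"

section \<open>Natural exponential family\<close>

definition natural_parameter_space ::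
    "(real ^ 'r) measure \<Rightarrow> (real ^ 'r \<Rightarrow> real) \<Rightarrow> (real ^ 'r) set" where
  "natural_parameter_space \<nu> b =
     {\<theta>. 0 < (\<integral>\<^sup>+ y. ennreal (exp (y \<bullet> \<theta> + b y)) \<partial>\<nu>) \<and>
          (\<integral>\<^sup>+ y. ennreal (exp (y \<bullet> \<theta> + b y)) \<partial>\<nu>) < \<infinity>}"

text \<open>The function \<open>a\<close> of the family. It is determined by \<open>\<nu>\<close> and \<open>b\<close>, because
  \<open>exp (y \<bullet> \<theta> - a \<theta> + b y)\<close> is a probability density; the value is meaningful only on the
  natural parameter space.\<close>

definition log_partition ::
    "(real ^ 'r) measure \<Rightarrow> (real ^ 'r \<Rightarrow> real) \<Rightarrow> real ^ 'r \<Rightarrow> real" where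
  "log_partition \<nu> b \<theta> = ln (\<integral> y. exp (y \<bullet> \<theta> + b y) \<partial>\<nu>)"

definition nef_density ::
    "(real ^ 'r) measure \<Rightarrow> (real ^ 'r \<Rightarrow> real) \<Rightarrow> real ^ 'r \<Rightarrow> real ^ 'r \<Rightarrow> real" where
  "nef_density \<nu> b \<theta> y = exp (y \<bullet> \<theta> - log_partition \<nu> b \<theta> + b y)"

text \<open>For \<open>\<theta>\<close> in the interior of the natural parameter space the Hessian of \<open>log_partition\<close>
  is the covariance matrix of a random vector with density \<open>nef_density \<nu> b \<theta>\<close>.\<close>

definition natural_exponential_family ::
    "(real ^ 'r) measure \<Rightarrow> (real ^ 'r \<Rightarrow> real) \<Rightarrow> bool" where
  "natural_exponential_family \<nu> b \<longleftrightarrow>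
     sigma_finite_measure \<nu> \<and> sets \<nu> = sets borel \<and> b \<in> borel_measurable borel \<and>
     (\<forall>\<theta> \<in> interior (natural_parameter_space \<nu> b).
        positive_definite (hessian (log_partition \<nu> b) \<theta>))"

section \<open>Generalized linear model\<close>

definition loglik ::
    "(real ^ 'r) measure \<Rightarrow> (real ^ 'r \<Rightarrow> real) \<Rightarrow> real ^ 'r \<Rightarrow> real ^ 'p ^ 'r \<Rightarrow> real ^ 'p \<Rightarrow> real" where
  "loglik \<nu> b y X \<beta> = y \<bullet> (X *v \<beta>) - log_partition \<nu> b (X *v \<beta>) + b y"

definition glm_info ::
    "(real ^ 'r) measure \<Rightarrow> (real ^ 'r \<Rightarrow> real) \<Rightarrow> real ^ 'p \<Rightarrow> real ^ 'p ^ 'r \<Rightarrow> real ^ 'p ^ 'p" where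
  "glm_info \<nu> b \<beta> X = transpose X ** hessian (log_partition \<nu> b) (X *v \<beta>) ** X"

definition cond_C1 ::
    "(real ^ 'r) measure \<Rightarrow> (real ^ 'r \<Rightarrow> real) \<Rightarrow> (real ^ 'p ^ 'r) set \<Rightarrow> (real ^ 'p) set \<Rightarrow> bool" where
  "cond_C1 \<nu> b \<X> B \<longleftrightarrow>
     compact \<X> \<and> (\<forall>X \<in> \<X>. \<forall>\<beta> \<in> B. X *v \<beta> \<in> interior (natural_parameter_space \<nu> b))"

text \<open>The regressors are deterministic; that \<open>\<mu>\<close> is invariant for them is taken to mean that the
  averages of \<open>glm_info\<close> along the sequence converge to the \<open>\<mu>\<close>-integral. This is weaker than
  weak convergence of the empirical distributions of the regressors to \<open>\<mu>\<close>. The integral runs over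
  \<open>\<X>\<close> because \<open>glm_info\<close> is unspecified where the Hessian does not exist.\<close>

definition cond_C2 ::
    "(real ^ 'r) measure \<Rightarrow> (real ^ 'r \<Rightarrow> real) \<Rightarrow> (real ^ 'p ^ 'r) set \<Rightarrow> (real ^ 'p) set \<Rightarrow>
     (nat \<Rightarrow> real ^ 'p ^ 'r) \<Rightarrow> bool" where
  "cond_C2 \<nu> b \<X> B X \<longleftrightarrow>
     (\<exists>\<mu>. prob_space \<mu> \<and> sets \<mu> = sets borel \<and> measure \<mu> \<X> = 1 \<and>
        (\<forall>\<beta> \<in> B.
           let J = (LINT x:\<X>|\<mu>. glm_info \<nu> b \<beta> x) in
             positive_definite J \<and>
             (\<lambda>n. (1 / real n) *\<^sub>R (\<Sum>i = 1..n. glm_info \<nu> b \<beta> (X i))) \<longlonglongrightarrow> J))"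

section \<open>Penalty\<close>

text \<open>Sample sizes are \<open>n \<ge> 1\<close>. The value at \<open>n = 0\<close> is \<open>0\<close>, for which the conditions below
  would be contradictory.\<close>

definition tuning :: "real \<Rightarrow> real \<Rightarrow> nat \<Rightarrow> real" where
  "tuning \<gamma>\<^sub>0 lam n = real n powr ((\<gamma>\<^sub>0 - 2) / 2) * lam"

text \<open>In the following, \<open>\<eta> l\<close> is the penalty function with tuning parameter \<open>l\<close>, and \<open>L n\<close> is
  the tuning parameter at sample size \<open>n\<close>.\<close>

definition cond_P1 :: "(real \<Rightarrow> real \<Rightarrow> real) \<Rightarrow> (nat \<Rightarrow> real) \<Rightarrow> bool" where
  "cond_P1 \<eta> L \<longleftrightarrow> (\<forall>n\<ge>1.
     (\<forall>t. \<eta> (L n) differentiable (at t) \<longleftrightarrow> t \<noteq> 0) \<and>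
     (\<forall>t. \<eta> (L n) (- t) = \<eta> (L n) t) \<and>
     (\<forall>s t. \<bar>s\<bar> \<le> \<bar>t\<bar> \<longrightarrow> \<eta> (L n) s \<le> \<eta> (L n) t))"

definition cond_P2 :: "(real \<Rightarrow> real \<Rightarrow> real) \<Rightarrow> (nat \<Rightarrow> real) \<Rightarrow> bool" where
  "cond_P2 \<eta> L \<longleftrightarrow> (\<forall>n\<ge>1.
     ((\<lambda>t. \<eta> (L n) t / \<bar>t\<bar>) \<longlongrightarrow> L n) (at 0) \<and>
     \<eta> (L n) 0 = 0 \<and>
     ((\<lambda>t. deriv (\<eta> (L n)) t / sgn t) \<longlongrightarrow> L n) (at 0))"

text \<open>The limit of \<open>cond_P2\<close> at the scale of the estimation error:
  \<open>\<eta>\<^bsub>L n\<^esub> (t\<^sub>n) / \<bar>t\<^sub>n\<bar>\<close> is asymptotic to \<open>L n\<close> for every nonzero \<open>t\<^sub>n = O(n\<^sup>-\<^sup>1\<^sup>/\<^sup>2)\<close>.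
  The limits for each fixed \<open>n\<close> do not control this: a penalty with slope \<open>L n\<close> only for
  \<open>\<bar>t\<bar> < exp (- n)\<close> and constant beyond \<open>2 exp (- n)\<close> satisfies all other conditions, but is
  negligible, so that no coefficient need be estimated as zero. For \<open>L n = tuning \<gamma>\<^sub>0 lam n\<close>
  with \<open>\<gamma>\<^sub>0 > 1\<close> one has \<open>n\<^sup>-\<^sup>1\<^sup>/\<^sup>2 = o(L n)\<close>, and the condition holds for all penalties
  \<open>\<eta> l t = l\<^sup>2 * h (t / l)\<close> with \<open>h t / \<bar>t\<bar> \<longlongrightarrow> 1\<close> at \<open>0\<close>, in particular SCAD and MCP.\<close>

definition cond_P2_local :: "(real \<Rightarrow> real \<Rightarrow> real) \<Rightarrow> (nat \<Rightarrow> real) \<Rightarrow> bool" where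
  "cond_P2_local \<eta> L \<longleftrightarrow>
     (\<forall>t :: nat \<Rightarrow> real. (\<forall>n. t n \<noteq> 0) \<and> t \<in> O(\<lambda>n. 1 / sqrt (real n)) \<longrightarrow>
        (\<lambda>n. \<eta> (L n) (t n) / \<bar>t n\<bar>) \<sim>[at_top] L)"

definition cond_P3 :: "(real \<Rightarrow> real \<Rightarrow> real) \<Rightarrow> (nat \<Rightarrow> real) \<Rightarrow> bool" where
  "cond_P3 \<eta> L \<longleftrightarrow> (\<forall>t. (\<lambda>n. \<eta> (L n) t) \<longlonglongrightarrow> 0)"

definition cond_P4 :: "(real \<Rightarrow> real \<Rightarrow> real) \<Rightarrow> (nat \<Rightarrow> real) \<Rightarrow> bool" where
  "cond_P4 \<eta> L \<longleftrightarrow> (\<exists>\<tau>>0. \<forall>n\<ge>1. \<forall>t. \<bar>t\<bar> \<ge> \<tau> * L n \<longrightarrow> deriv (\<eta> (L n)) t = 0)"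

text \<open>Second derivatives are required only for large \<open>n\<close>, at each fixed point; SCAD, for instance,
  has kinks in its derivative at points of order \<open>L n\<close>.\<close>

definition cond_P5 :: "(real \<Rightarrow> real \<Rightarrow> real) \<Rightarrow> (nat \<Rightarrow> real) \<Rightarrow> bool" where
  "cond_P5 \<eta> L \<longleftrightarrow> (\<forall>t. t \<noteq> 0 \<longrightarrow>
     (\<forall>\<^sub>F n in sequentially. deriv (\<eta> (L n)) differentiable (at t)) \<and>
     (\<lambda>n. deriv (deriv (\<eta> (L n))) t) \<longlonglongrightarrow> 0)"

section \<open>Estimator\<close>

definition penalized_objective ::
    "(real ^ 'r) measure \<Rightarrow> (real ^ 'r \<Rightarrow> real) \<Rightarrow> (real \<Rightarrow> real) \<Rightarrow> nat \<Rightarrow>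
     (nat \<Rightarrow> real ^ 'r) \<Rightarrow> (nat \<Rightarrow> real ^ 'p ^ 'r) \<Rightarrow> real ^ 'p \<Rightarrow> real" where
  "penalized_objective \<nu> b h n y X \<beta> =
     - (\<Sum>i = 1..n. loglik \<nu> b (y i) (X i) \<beta>) + real n * (\<Sum>j\<in>UNIV. h (\<beta> $ j))"

text \<open>The argmin need not be unique, and for some data it need not exist (\<open>B\<close> is open, and
  \<open>\<eta>\<close> may be bounded). An estimator is any random vector that is a global minimizer whenever
  there is one; it is arbitrary otherwise.\<close>

definition penalized_mle ::
    "'w measure \<Rightarrow> (real ^ 'r) measure \<Rightarrow> (real ^ 'r \<Rightarrow> real) \<Rightarrow> (real \<Rightarrow> real) \<Rightarrow> (real ^ 'p) set \<Rightarrow>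
     nat \<Rightarrow> (nat \<Rightarrow> 'w \<Rightarrow> real ^ 'r) \<Rightarrow> (nat \<Rightarrow> real ^ 'p ^ 'r) \<Rightarrow> ('w \<Rightarrow> real ^ 'p) \<Rightarrow> bool" where
  "penalized_mle M \<nu> b h B n Y X est \<longleftrightarrow>
     est \<in> borel_measurable M \<and>
     (\<forall>\<omega> \<in> space M.
        let Q = penalized_objective \<nu> b h n (\<lambda>i. Y i \<omega>) X in
          (\<exists>\<beta>. is_arg_min Q (\<lambda>\<beta>. \<beta> \<in> B) \<beta>) \<longrightarrow> is_arg_min Q (\<lambda>\<beta>. \<beta> \<in> B) (est \<omega>))"

end

theory Submission
  imports Defs
begin

text \<open>The log-partition function is smooth on the interior of the natural parameter space, with the
  mean as gradient. Hence, by compactness of the regressors and (C2), the negative log-likelihood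
  is convex and, at \<open>\<beta>\<^sup>* + \<delta>\<close> for small \<open>\<delta>\<close>, exceeds its value at \<open>\<beta>\<^sup>*\<close> by at least
  \<open>n c \<parallel>\<delta>\<parallel>\<^sup>2 - \<parallel>s\<^sub>n\<parallel> \<parallel>\<delta>\<parallel>\<close>, where the score \<open>s\<^sub>n\<close> is a sum of independent centred vectors
  with bounded second moments, so that \<open>\<parallel>s\<^sub>n\<parallel> < K \<surd>n\<close> with probability close to \<open>1\<close>.
  On this event the minimizer exists and is within \<open>O(n\<^sup>-\<^sup>1\<^sup>/\<^sup>2)\<close> of \<open>\<beta>\<^sup>*\<close>, because the
  penalty is constant near the nonzero coordinates of \<open>\<beta>\<^sup>*\<close>. At that distance the penalty of
  a spurious nonzero coordinate has slope of order \<open>n L\<^sub>n\<close> for the tuning parameter \<open>L\<^sub>n\<close>, which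
  dominates the slope \<open>O(\<surd>n)\<close> of the log-likelihood, since \<open>\<surd>n L\<^sub>n \<longrightarrow> \<infinity>\<close>.\<close>

section \<open>Smoothness of the log-partition function\<close>

text \<open>The penalty need not be convex, so neither convexity of the objective nor stationarity
  singles out its minimizers. They are controlled by comparing values: with the true parameter for
  localization, and with a copy whose spurious coordinates are zeroed for the support. Two radii are
  needed. The first is fixed: (P3) makes the penalty at the true parameter negligible, and
  everything farther away, even in an unbounded \<open>B\<close>, is excluded since the penalty is
  nonnegative. Only inside that ball are the true coordinates certain to stay where the penalty is
  flat, which yields the second, shrinking radius. (C2) gives curvature of an average at a single
  parameter, and one regressor may have singular information. Hence each term is expanded with an
  error uniform over \<open>\<X>\<close>, and positivity is used only after summation. The data
  enter linearly in the coefficients, so the bounds depend on them only through the score.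
  Probability reduces to one Chebyshev estimate; the rest is deterministic, with a threshold for n
  that is the same for all data.\<close>

definition subexponential :: "(real ^ 'r \<Rightarrow> real) \<Rightarrow> bool" where
  "subexponential g \<longleftrightarrow> g \<in> borel_measurable borel \<and>
     (\<forall>c>0. \<exists>C. \<forall>y. \<bar>g y\<bar> \<le> C * exp (c * norm y))"

text \<open>Unnormalized moments; the constant \<open>g = 1\<close> gives the normalizing integral.
  Differentiation in coordinate \<open>i\<close> replaces \<open>g y\<close> by
  \<open>g y * y $ i\<close>, so with subexponential \<open>g\<close> the family is closed under
  differentiation.\<close>

definition exp_moment ::
    "(real ^ 'r) measure \<Rightarrow> (real ^ 'r \<Rightarrow> real) \<Rightarrow> (real ^ 'r \<Rightarrow> real) \<Rightarrow> real ^ 'r \<Rightarrow> real" where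
  "exp_moment \<nu> b g \<theta> = (\<integral>y. g y * exp (y \<bullet> \<theta> + b y) \<partial>\<nu>)"

lemma subexponential_1: "subexponential (\<lambda>_. 1)"
  unfolding subexponential_def by (auto intro!: exI[of _ 1])

lemma le_exp_mult:
  fixes x c :: real assumes "c > 0"
  shows "x \<le> exp (c * x) / c"
proof -
  have "c * x \<le> exp (c * x)" using exp_ge_add_one_self[of "c * x"] by linarith
  then show ?thesis using assms by (simp add: field_simps)
qed

text \<open>The rate \<open>c\<close> is split: one half bounds \<open>g\<close>, the other absorbs
  the linear factor through \<open>le_exp_mult\<close>.\<close>

lemma subexponential_mult_component:
  fixes g :: "real ^ 'r \<Rightarrow> real"
  assumes "subexponential g"
  shows "subexponential (\<lambda>y. g y * y $ i)"
  unfolding subexponential_def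
proof (intro conjI allI impI)
  have [measurable]: "g \<in> borel_measurable borel"
    using assms by (simp add: subexponential_def)
  show "(\<lambda>y. g y * y $ i) \<in> borel_measurable borel" by measurable
  fix c :: real assume c: "c > 0"
  then obtain C where C: "\<bar>g y\<bar> \<le> C * exp (c / 2 * norm y)" for y
    using assms unfolding subexponential_def by (meson half_gt_zero)
  show "\<exists>C. \<forall>y. \<bar>g y * y $ i\<bar> \<le> C * exp (c * norm y)"
  proof (intro exI allI)
    fix y
    have "\<bar>g y * y $ i\<bar> = \<bar>g y\<bar> * \<bar>y $ i\<bar>" by (rule abs_mult)
    also have "\<dots> \<le> (C * exp (c / 2 * norm y)) * (exp (c / 2 * norm y) / (c / 2))"
    proof (rule mult_mono)
      show "\<bar>y $ i\<bar> \<le> exp (c / 2 * norm y) / (c / 2)"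
        using component_le_norm_cart[of y i] le_exp_mult[of "c / 2" "norm y"] c by linarith
      show "0 \<le> C * exp (c / 2 * norm y)" using C[of y] by linarith
    qed (use C in auto)
    also have "\<dots> = (C / (c / 2)) * exp (c / 2 * norm y + c / 2 * norm y)"
      by (simp add: mult_exp_exp)
    also have "\<dots> = (C / (c / 2)) * exp (c * norm y)" by simp
    finally show "\<bar>g y * y $ i\<bar> \<le> (C / (c / 2)) * exp (c * norm y)" .
  qed
qed

lemma norm_power2_vec: "(norm (x :: real ^ 'n))\<^sup>2 = (\<Sum>i\<in>UNIV. (x $ i)\<^sup>2)"
  by (simp add: norm_vec_def L2_set_def sum_nonneg)

text \<open>Some coordinate carries at least the fraction \<open>1 / CARD('r)\<close> of the norm.
  The exponential of the norm is thus dominated by exponentials of linear forms, and multiplying by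
  those only shifts the natural parameter along an axis.\<close>

lemma exp_norm_le_sum:
  fixes y :: "real ^ 'r" assumes "c \<ge> 0"
  shows "exp (c * norm y) \<le> (\<Sum>i\<in>UNIV. exp (y \<bullet> axis i (c * CARD('r))) + exp (y \<bullet> axis i (- (c * CARD('r)))))"
proof -
  have "\<exists>i. norm y \<le> CARD('r) * \<bar>y $ i\<bar>"
  proof (rule ccontr)
    assume "\<nexists>i. norm y \<le> CARD('r) * \<bar>y $ i\<bar>"
    then have *: "\<bar>y $ i\<bar> < norm y / CARD('r)" for i
      by (simp add: not_le field_simps)
    have "norm y \<le> (\<Sum>i\<in>UNIV. \<bar>y $ i\<bar>)" by (rule norm_le_l1_cart)
    also have "\<dots> < (\<Sum>i\<in>(UNIV::'r set). norm y / CARD('r))"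
      by (intro sum_strict_mono) (use * in auto)
    also have "\<dots> = norm y" by simp
    finally show False by simp
  qed
  then obtain i where i: "norm y \<le> CARD('r) * \<bar>y $ i\<bar>" ..
  have "exp (c * norm y) \<le> exp (c * (CARD('r) * \<bar>y $ i\<bar>))"
    using i assms by (simp add: mult_left_mono)
  also have "\<dots> \<le> exp (y \<bullet> axis i (c * CARD('r))) + exp (y \<bullet> axis i (- (c * CARD('r))))"
    by (cases "y $ i \<ge> 0") (simp_all add: inner_axis mult.commute mult.left_commute)
  also have "\<dots> \<le> (\<Sum>i\<in>UNIV. exp (y \<bullet> axis i (c * CARD('r))) + exp (y \<bullet> axis i (- (c * CARD('r)))))"
    by (rule member_le_sum) (auto intro!: add_nonneg_nonneg)
  finally show ?thesis .
qed

lemma abs_exp_minus_affine_le: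
  fixes x :: real shows "\<bar>exp x - 1 - x\<bar> \<le> x\<^sup>2 * exp \<bar>x\<bar>"
proof -
  obtain t where t: "\<bar>t\<bar> \<le> \<bar>x\<bar>" "exp x = (\<Sum>m<2. x ^ m / fact m) + exp t / fact 2 * x ^ 2"
    using Maclaurin_exp_le by blast
  then have "\<bar>exp x - 1 - x\<bar> = x\<^sup>2 * (exp t / 2)" by (simp add: eval_nat_numeral)
  also have "\<dots> \<le> x\<^sup>2 * exp \<bar>x\<bar>"
  proof (rule mult_left_mono)
    have "exp t \<le> exp \<bar>x\<bar>" using t(1) by simp
    then show "exp t / 2 \<le> exp \<bar>x\<bar>" using exp_ge_zero[of "\<bar>x\<bar>"] by linarith
  qed simp
  finally show ?thesis .
qed

lemma has_derivative_imp_gradient: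
  assumes "(f has_derivative (\<lambda>h. D \<bullet> h)) (at x)"
  shows "gradient f x = D"
  unfolding gradient_def frechet_derivative_at[OF assms, symmetric]
  by (simp add: vec_eq_iff inner_axis)

context
  fixes \<nu> :: "(real ^ 'r) measure" and b :: "real ^ 'r \<Rightarrow> real"
  assumes sets_nu: "sets \<nu> = sets borel" and b_meas: "b \<in> borel_measurable borel"
begin

lemma borel_measurable_nu_iff: "f \<in> borel_measurable \<nu> \<longleftrightarrow> f \<in> borel_measurable borel"
  by (rule arg_cong[where f = "(\<in>) f"], rule measurable_cong_sets) (auto simp: sets_nu)

lemma borel_measurable_exp_inner:
  "(\<lambda>y. exp (y \<bullet> \<theta> + b y)) \<in> borel_measurable borel"
proof -
  note [measurable] = b_meas
  show ?thesis by measurable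
qed

lemma integrable_natural:
  assumes "\<theta> \<in> natural_parameter_space \<nu> b"
  shows "integrable \<nu> (\<lambda>y. exp (y \<bullet> \<theta> + b y))"
  using assms borel_measurable_exp_inner
  by (intro integrableI_nonneg) (auto simp: natural_parameter_space_def borel_measurable_nu_iff)

lemma exp_moment_1_pos:
  assumes "\<theta> \<in> natural_parameter_space \<nu> b"
  shows "exp_moment \<nu> b (\<lambda>_. 1) \<theta> > 0"
proof -
  have "ennreal (\<integral>y. exp (y \<bullet> \<theta> + b y) \<partial>\<nu>) = (\<integral>\<^sup>+ y. ennreal (exp (y \<bullet> \<theta> + b y)) \<partial>\<nu>)"
    by (rule nn_integral_eq_integral[symmetric]) (use integrable_natural[OF assms] in auto)
  also have "\<dots> > 0" using assms by (simp add: natural_parameter_space_def)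
  finally show ?thesis by (simp add: exp_moment_def)
qed

lemma log_partition_eq: "log_partition \<nu> b \<theta> = ln (exp_moment \<nu> b (\<lambda>_. 1) \<theta>)"
  by (simp add: log_partition_def exp_moment_def)

lemma integrable_exp_norm:
  assumes "\<theta> \<in> interior (natural_parameter_space \<nu> b)"
  obtains c where "c > 0" "integrable \<nu> (\<lambda>y. exp (c * norm y) * exp (y \<bullet> \<theta> + b y))"
proof -
  note [measurable] = b_meas
  obtain e where e: "e > 0" "ball \<theta> e \<subseteq> natural_parameter_space \<nu> b"
    using assms by (auto simp: mem_interior)
  \<comment> \<open>This makes the axis shifts of \<open>exp_norm_le_sum\<close> have length
    \<open>e / 2\<close>, so the shifted parameters stay in the ball of radius
    \<open>e\<close>.\<close>
  define c where "c = e / (2 * CARD('r))"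
  have c: "c > 0" "c * CARD('r) = e / 2" using e by (auto simp: c_def)
  have in_space: "\<theta> + axis i d \<in> natural_parameter_space \<nu> b" if "\<bar>d\<bar> = e / 2" for i d
    using e that by (intro subsetD[OF e(2)]) (auto simp: dist_norm norm_eq_sqrt_inner inner_axis_axis)
  have "integrable \<nu> (\<lambda>y. \<Sum>i\<in>UNIV. exp (y \<bullet> (\<theta> + axis i (c * CARD('r))) + b y)
          + exp (y \<bullet> (\<theta> + axis i (- (c * CARD('r)))) + b y))"
    by (intro Bochner_Integration.integrable_sum Bochner_Integration.integrable_add integrable_natural in_space)
       (use c e in auto)
  then have "integrable \<nu> (\<lambda>y. exp (c * norm y) * exp (y \<bullet> \<theta> + b y))"
  proof (rule Bochner_Integration.integrable_bound)
    show "(\<lambda>y. exp (c * norm y) * exp (y \<bullet> \<theta> + b y)) \<in> borel_measurable \<nu>"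
      unfolding borel_measurable_nu_iff by measurable
    show "AE y in \<nu>. norm (exp (c * norm y) * exp (y \<bullet> \<theta> + b y)) \<le> norm (\<Sum>i\<in>UNIV. exp (y \<bullet> (\<theta> + axis i (c * CARD('r))) + b y)
          + exp (y \<bullet> (\<theta> + axis i (- (c * CARD('r)))) + b y))"
    proof (rule AE_I2)
      fix y
      have "exp (c * norm y) * exp (y \<bullet> \<theta> + b y) \<le> (\<Sum>i\<in>UNIV. exp (y \<bullet> axis i (c * CARD('r)))
          + exp (y \<bullet> axis i (- (c * CARD('r))))) * exp (y \<bullet> \<theta> + b y)"
        by (intro mult_right_mono exp_norm_le_sum) (use c in auto)
      also have "\<dots> = (\<Sum>i\<in>UNIV. exp (y \<bullet> (\<theta> + axis i (c * CARD('r))) + b y)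
          + exp (y \<bullet> (\<theta> + axis i (- (c * CARD('r)))) + b y))"
        by (simp add: sum_distrib_right sum_distrib_left distrib_left inner_add_right exp_add mult_ac)
      finally show "norm (exp (c * norm y) * exp (y \<bullet> \<theta> + b y)) \<le> norm (\<Sum>i\<in>UNIV. exp (y \<bullet> (\<theta> + axis i (c * CARD('r))) + b y)
          + exp (y \<bullet> (\<theta> + axis i (- (c * CARD('r)))) + b y))" 
        by simp
    qed
  qed
  with c that show thesis by blast
qed

text \<open>Half of the rate from \<open>integrable_exp_norm\<close> pays for \<open>g\<close>, the
  other half remains. The remaining rate is the same for all \<open>g\<close>, so one
  \<open>c\<close> serves both \<open>g\<close> and its products with coordinates in the derivative
  below.\<close>

lemma integrable_subexponential_exp_norm:
  assumes "\<theta> \<in> interior (natural_parameter_space \<nu> b)"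
  obtains c where "c > 0"
    "\<And>g. subexponential g \<Longrightarrow> integrable \<nu> (\<lambda>y. g y * exp (c * norm y) * exp (y \<bullet> \<theta> + b y))"
proof -
  note [measurable] = b_meas
  obtain c where c: "c > 0" "integrable \<nu> (\<lambda>y. exp (c * norm y) * exp (y \<bullet> \<theta> + b y))"
    using integrable_exp_norm[OF assms] by blast
  have "integrable \<nu> (\<lambda>y. g y * exp (c / 2 * norm y) * exp (y \<bullet> \<theta> + b y))" if g: "subexponential g" for g
  proof -
    have [measurable]: "g \<in> borel_measurable borel" using g by (simp add: subexponential_def)
    obtain C where C: "\<bar>g y\<bar> \<le> C * exp (c / 2 * norm y)" for y
      using g c(1) unfolding subexponential_def by (meson half_gt_zero)
    from integrable_mult_right[OF c(2), of C]
    show ?thesis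
    proof (rule Bochner_Integration.integrable_bound)
      show "(\<lambda>y. g y * exp (c / 2 * norm y) * exp (y \<bullet> \<theta> + b y)) \<in> borel_measurable \<nu>"
        unfolding borel_measurable_nu_iff by measurable
      show "AE y in \<nu>. norm (g y * exp (c / 2 * norm y) * exp (y \<bullet> \<theta> + b y))
              \<le> norm (C * (exp (c * norm y) * exp (y \<bullet> \<theta> + b y)))"
      proof (rule AE_I2)
        fix y
        have "norm (g y * exp (c / 2 * norm y) * exp (y \<bullet> \<theta> + b y))
            = \<bar>g y\<bar> * (exp (c / 2 * norm y) * exp (y \<bullet> \<theta> + b y))" by (simp add: abs_mult)
        also have "\<dots> \<le> C * exp (c / 2 * norm y) * (exp (c / 2 * norm y) * exp (y \<bullet> \<theta> + b y))"
          by (intro mult_right_mono C) auto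
        also have "\<dots> = C * (exp (c / 2 * norm y + c / 2 * norm y) * exp (y \<bullet> \<theta> + b y))"
          by (simp only: exp_add mult.assoc)
        also have "\<dots> = C * (exp (c * norm y) * exp (y \<bullet> \<theta> + b y))" by simp
        finally show "norm (g y * exp (c / 2 * norm y) * exp (y \<bullet> \<theta> + b y))
              \<le> norm (C * (exp (c * norm y) * exp (y \<bullet> \<theta> + b y)))" by simp
      qed
    qed
  qed
  with c(1) that[of "c / 2"] show thesis by simp
qed

lemma integrable_subexponential_shift:
  assumes g: "subexponential g" and h: "norm h \<le> c"
    and int: "integrable \<nu> (\<lambda>y. g y * exp (c * norm y) * exp (y \<bullet> \<theta> + b y))"
  shows "integrable \<nu> (\<lambda>y. g y * exp (y \<bullet> (\<theta> + h) + b y))"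
  using int
proof (rule Bochner_Integration.integrable_bound)
  note [measurable] = b_meas
  have [measurable]: "g \<in> borel_measurable borel" using g by (simp add: subexponential_def)
  show "(\<lambda>y. g y * exp (y \<bullet> (\<theta> + h) + b y)) \<in> borel_measurable \<nu>"
    unfolding borel_measurable_nu_iff by measurable
  show "AE y in \<nu>. norm (g y * exp (y \<bullet> (\<theta> + h) + b y))
      \<le> norm (g y * exp (c * norm y) * exp (y \<bullet> \<theta> + b y))"
  proof (rule AE_I2)
    fix y
    have "y \<bullet> h \<le> norm y * norm h" by (rule norm_cauchy_schwarz)
    also have "\<dots> \<le> norm y * c" by (intro mult_left_mono h) auto
    finally have "exp (y \<bullet> (\<theta> + h) + b y) \<le> exp (c * norm y) * exp (y \<bullet> \<theta> + b y)"
      unfolding exp_add[symmetric] by (simp add: inner_add_right mult.commute)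
    then show "norm (g y * exp (y \<bullet> (\<theta> + h) + b y))
      \<le> norm (g y * exp (c * norm y) * exp (y \<bullet> \<theta> + b y))"
      by (simp add: abs_mult mult_left_mono mult.assoc)
  qed
qed

lemma integrable_subexponential:
  assumes "subexponential g" "\<theta> \<in> interior (natural_parameter_space \<nu> b)"
  shows "integrable \<nu> (\<lambda>y. g y * exp (y \<bullet> \<theta> + b y))"
proof -
  obtain c where "c > 0"
    "integrable \<nu> (\<lambda>y. g y * exp (c * norm y) * exp (y \<bullet> \<theta> + b y))"
    using integrable_subexponential_exp_norm[OF assms(2)] assms(1) by metis
  then show ?thesis
    using integrable_subexponential_shift[OF assms(1), of 0 c \<theta>] by simp
qed

text \<open>Differentiation under the integral: the remainder is at most \<open>\<parallel>h\<parallel>\<^sup>2\<close> times an integral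
  that does not depend on \<open>h\<close>.\<close>

lemma has_derivative_exp_moment:
  assumes g: "subexponential g" and \<theta>: "\<theta> \<in> interior (natural_parameter_space \<nu> b)"
  shows "(exp_moment \<nu> b g has_derivative
           (\<lambda>h. (\<chi> i. exp_moment \<nu> b (\<lambda>y. g y * y $ i) \<theta>) \<bullet> h)) (at \<theta>)"
proof -
  note [measurable] = b_meas
  have gm[measurable]: "g \<in> borel_measurable borel" using g by (simp add: subexponential_def)
  obtain c where c: "c > 0"
    "\<And>g. subexponential g \<Longrightarrow> integrable \<nu> (\<lambda>y. g y * exp (c * norm y) * exp (y \<bullet> \<theta> + b y))"
    using integrable_subexponential_exp_norm[OF \<theta>] by blast
  define w where "w y = exp (y \<bullet> \<theta> + b y)" for y
  \<comment> \<open>The dominating function: the second-order remainder of the exponential is at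
    most \<open>(y \<bullet> h)\<^sup>2 * exp \<bar>y \<bullet> h\<bar>\<close>, and Cauchy-Schwarz
    with \<open>norm h \<le> c\<close> separates \<open>(norm h)\<^sup>2\<close> from this
    factor.\<close>
  define K where "K y = \<bar>g y\<bar> * (norm y)\<^sup>2 * exp (c * norm y) * w y" for y
  \<comment> \<open>Splitting the squared norm into coordinates exhibits \<open>K\<close> as a sum
    of absolute values of functions integrable by \<open>c(2)\<close>.\<close>
  have K_eq: "K y = (\<Sum>i\<in>UNIV. \<bar>g y * y $ i * y $ i * exp (c * norm y) * exp (y \<bullet> \<theta> + b y)\<bar>)" for y
  proof -
    have "\<bar>g y * y $ i * y $ i * exp (c * norm y) * exp (y \<bullet> \<theta> + b y)\<bar>
        = \<bar>g y\<bar> * (y $ i)\<^sup>2 * exp (c * norm y) * w y" for i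
      by (simp add: abs_mult power2_eq_square w_def)
    then show ?thesis
      by (simp add: K_def norm_power2_vec sum_distrib_left sum_distrib_right)
  qed
  have K_int: "integrable \<nu> K"
    unfolding K_eq
    by (intro Bochner_Integration.integrable_sum integrable_abs c(2) subexponential_mult_component g)
  define R where "R = (\<integral>y. K y \<partial>\<nu>)"
  have int_g: "integrable \<nu> (\<lambda>y. g y * w y)"
    unfolding w_def by (rule integrable_subexponential[OF g \<theta>])
  have int_gi: "integrable \<nu> (\<lambda>y. g y * y $ i * w y)" for i
    unfolding w_def
    by (rule integrable_subexponential[OF subexponential_mult_component[OF g] \<theta>])
  have inner_eq: "(\<chi> i. exp_moment \<nu> b (\<lambda>y. g y * y $ i) \<theta>) \<bullet> h = (\<integral>y. g y * (y \<bullet> h) * w y \<partial>\<nu>)"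
    and inner_int: "integrable \<nu> (\<lambda>y. g y * (y \<bullet> h) * w y)" for h
  proof -
    have eq: "g y * (y \<bullet> h) * w y = (\<Sum>i\<in>UNIV. (g y * y $ i * w y) * h $ i)" for y
      by (simp add: inner_vec_def sum_distrib_left sum_distrib_right mult_ac)
    have int: "integrable \<nu> (\<lambda>y. (g y * y $ i * w y) * h $ i)" for i
      by (intro integrable_mult_left int_gi)
    show "integrable \<nu> (\<lambda>y. g y * (y \<bullet> h) * w y)"
      unfolding eq by (intro Bochner_Integration.integrable_sum int)
    show "(\<chi> i. exp_moment \<nu> b (\<lambda>y. g y * y $ i) \<theta>) \<bullet> h = (\<integral>y. g y * (y \<bullet> h) * w y \<partial>\<nu>)"
      unfolding eq using int
      by (simp add: Bochner_Integration.integral_sum inner_vec_def exp_moment_def w_def)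
  qed
  have rem: "\<bar>exp_moment \<nu> b g (\<theta> + h) - exp_moment \<nu> b g \<theta>
      - (\<chi> i. exp_moment \<nu> b (\<lambda>y. g y * y $ i) \<theta>) \<bullet> h\<bar> \<le> (norm h)\<^sup>2 * R"
    if h: "norm h \<le> c" for h
  proof -
    define D where "D y = g y * exp (y \<bullet> (\<theta> + h) + b y) - g y * w y - g y * (y \<bullet> h) * w y" for y
    have int_h: "integrable \<nu> (\<lambda>y. g y * exp (y \<bullet> (\<theta> + h) + b y))"
      by (rule integrable_subexponential_shift[OF g h c(2)[OF g]])
    have D_int: "integrable \<nu> D"
      unfolding D_def by (intro Bochner_Integration.integrable_diff int_h int_g inner_int)
    have "exp_moment \<nu> b g (\<theta> + h) - exp_moment \<nu> b g \<theta>
      - (\<chi> i. exp_moment \<nu> b (\<lambda>y. g y * y $ i) \<theta>) \<bullet> h = (\<integral>y. D y \<partial>\<nu>)"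
      unfolding D_def inner_eq using int_h int_g inner_int[of h]
      by (simp add: exp_moment_def w_def[symmetric])
    also have "\<bar>\<dots>\<bar> \<le> (\<integral>y. (norm h)\<^sup>2 * K y \<partial>\<nu>)"
    proof -
      have "\<bar>D y\<bar> \<le> (norm h)\<^sup>2 * K y" for y
      proof -
        have yh: "\<bar>y \<bullet> h\<bar> \<le> norm y * norm h" by (rule Cauchy_Schwarz_ineq2)
        also have "\<dots> \<le> c * norm y" using mult_left_mono[OF h norm_ge_zero[of y]] by (simp add: mult.commute)
        finally have yc: "\<bar>y \<bullet> h\<bar> \<le> c * norm y" .
        have "D y = g y * w y * (exp (y \<bullet> h) - 1 - y \<bullet> h)"
          by (simp add: D_def w_def inner_add_right exp_add algebra_simps)
        then have "\<bar>D y\<bar> = \<bar>g y\<bar> * w y * \<bar>exp (y \<bullet> h) - 1 - y \<bullet> h\<bar>"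
          by (simp add: abs_mult w_def)
        also have "\<dots> \<le> \<bar>g y\<bar> * w y * ((norm y * norm h)\<^sup>2 * exp (c * norm y))"
        proof (rule mult_left_mono)
          have "\<bar>exp (y \<bullet> h) - 1 - y \<bullet> h\<bar> \<le> \<bar>y \<bullet> h\<bar>\<^sup>2 * exp \<bar>y \<bullet> h\<bar>"
            using abs_exp_minus_affine_le[of "y \<bullet> h"] by simp
          also have "\<dots> \<le> (norm y * norm h)\<^sup>2 * exp (c * norm y)"
            by (intro mult_mono power_mono) (use yh yc in auto)
          finally show "\<bar>exp (y \<bullet> h) - 1 - y \<bullet> h\<bar> \<le> (norm y * norm h)\<^sup>2 * exp (c * norm y)" .
        qed (simp add: w_def)
        also have "\<dots> = (norm h)\<^sup>2 * K y" by (simp add: K_def power_mult_distrib mult_ac)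
        finally show ?thesis .
      qed
      then show ?thesis
        using Bochner_Integration.integral_norm_bound_integral[OF D_int, of "\<lambda>y. (norm h)\<^sup>2 * K y"] K_int by simp
    qed
    also have "\<dots> = (norm h)\<^sup>2 * R" by (simp add: R_def)
    finally show ?thesis .
  qed
  show ?thesis
  proof (rule has_derivativeI_sandwich[OF c(1)])
    show "bounded_linear (\<lambda>h. (\<chi> i. exp_moment \<nu> b (\<lambda>y. g y * y $ i) \<theta>) \<bullet> h)"
      by (rule bounded_linear_inner_right)
    show "norm (exp_moment \<nu> b g y - exp_moment \<nu> b g \<theta>
        - (\<chi> i. exp_moment \<nu> b (\<lambda>y. g y * y $ i) \<theta>) \<bullet> (y - \<theta>)) / norm (y - \<theta>) \<le> norm (y - \<theta>) * R"
      if "y \<noteq> \<theta>" "dist y \<theta> < c" for y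
      using rem[of "y - \<theta>"] that by (simp add: dist_norm divide_simps power2_eq_square mult_ac)
    show "((\<lambda>y. norm (y - \<theta>) * R) \<longlongrightarrow> 0) (at \<theta>)"
      by (auto intro!: tendsto_eq_intros)
  qed
qed

section \<open>Gradient and Hessian of the log-partition function as mean and covariance\<close>

abbreviation (input) "Z \<equiv> exp_moment \<nu> b (\<lambda>_. 1)"
text \<open>The factor \<open>1\<close> is kept so that these are literally the moments that
  \<open>has_derivative_exp_moment\<close> produces from the constant function.\<close>

abbreviation (input) "Z\<^sub>1 i \<equiv> exp_moment \<nu> b (\<lambda>y. 1 * y $ i)"
abbreviation (input) "Z\<^sub>2 i j \<equiv> exp_moment \<nu> b (\<lambda>y. 1 * y $ i * y $ j)"

lemma has_derivative_log_partition:
  assumes \<theta>: "\<theta> \<in> interior (natural_parameter_space \<nu> b)"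
  shows "(log_partition \<nu> b has_derivative (\<lambda>h. (\<chi> i. Z\<^sub>1 i \<theta> / Z \<theta>) \<bullet> h)) (at \<theta>)"
proof -
  have pos: "Z \<theta> > 0"
    using exp_moment_1_pos \<theta> interior_subset by blast
  have "(\<chi> i. Z\<^sub>1 i \<theta> / Z \<theta>) = inverse (Z \<theta>) *\<^sub>R (\<chi> i. Z\<^sub>1 i \<theta>)"
    by (simp add: vec_eq_iff divide_inverse mult.commute)
  then show ?thesis
    using has_derivative_ln[OF pos has_derivative_exp_moment[OF subexponential_1 \<theta>]]
    by (simp add: log_partition_eq[abs_def] mult.commute)
qed

lemma gradient_log_partition:
  assumes "\<theta> \<in> interior (natural_parameter_space \<nu> b)"
  shows "gradient (log_partition \<nu> b) \<theta> = (\<chi> i. Z\<^sub>1 i \<theta> / Z \<theta>)"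
  by (rule has_derivative_imp_gradient[OF has_derivative_log_partition[OF assms]])

lemma has_derivative_gradient_component:
  assumes \<theta>: "\<theta> \<in> interior (natural_parameter_space \<nu> b)"
  shows "((\<lambda>\<theta>. Z\<^sub>1 i \<theta> / Z \<theta>) has_derivative
    (\<lambda>h. (\<chi> j. Z\<^sub>2 i j \<theta> / Z \<theta> - Z\<^sub>1 i \<theta> * Z\<^sub>1 j \<theta> / (Z \<theta>)\<^sup>2) \<bullet> h)) (at \<theta>)"
proof -
  have pos: "Z \<theta> > 0"
    using exp_moment_1_pos \<theta> interior_subset by blast
  have eq: "(\<chi> j. Z\<^sub>2 i j \<theta> / Z \<theta> - Z\<^sub>1 i \<theta> * Z\<^sub>1 j \<theta> / (Z \<theta>)\<^sup>2)
      = (1 / Z \<theta>) *\<^sub>R (\<chi> j. Z\<^sub>2 i j \<theta>) - (Z\<^sub>1 i \<theta> / (Z \<theta>)\<^sup>2) *\<^sub>R (\<chi> j. Z\<^sub>1 j \<theta>)"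
    by (simp add: vec_eq_iff)
  have quotient: "(u * z - v * w) / (z * z) = (1 / z) * u - (v / z\<^sup>2) * w" if "z > 0" for u v w z :: real
    using that by (simp add: field_simps power2_eq_square)
  note deriv_Z = has_derivative_exp_moment[OF subexponential_1 \<theta>]
  note deriv_Z\<^sub>1 = has_derivative_exp_moment[OF subexponential_mult_component[OF subexponential_1] \<theta>]
  show ?thesis
    unfolding eq inner_diff_left inner_scaleR_left quotient[OF pos, symmetric]
    using has_derivative_divide'[OF deriv_Z\<^sub>1[of i] deriv_Z] pos by simp
qed

lemma has_derivative_gradient_log_partition:
  assumes \<theta>: "\<theta> \<in> interior (natural_parameter_space \<nu> b)"
  shows "(gradient (log_partition \<nu> b) has_derivative
    (\<lambda>h. (\<chi> i j. Z\<^sub>2 i j \<theta> / Z \<theta> - Z\<^sub>1 i \<theta> * Z\<^sub>1 j \<theta> / (Z \<theta>)\<^sup>2) *v h)) (at \<theta>)"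
proof -
  have "((\<lambda>\<theta>. \<chi> i. Z\<^sub>1 i \<theta> / Z \<theta>) has_derivative
    (\<lambda>h. (\<chi> i j. Z\<^sub>2 i j \<theta> / Z \<theta> - Z\<^sub>1 i \<theta> * Z\<^sub>1 j \<theta> / (Z \<theta>)\<^sup>2) *v h)) (at \<theta>)"
  proof (subst has_derivative_componentwise_within, rule ballI)
    fix e :: "real ^ 'r" assume "e \<in> Basis"
    then obtain k where e: "e = axis k 1" by (auto simp: Basis_vec_def)
    have row: "((\<chi> i j. A i j) *v h) \<bullet> e = (\<chi> j. A k j) \<bullet> h" for A and h :: "real ^ 'r"
      by (simp add: e inner_axis matrix_vector_mult_def) (simp add: inner_vec_def)
    have comp: "(\<chi> i. A i) \<bullet> e = A k" for A :: "'r \<Rightarrow> real" by (simp add: e inner_axis)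
    show "((\<lambda>\<theta>. (\<chi> i. Z\<^sub>1 i \<theta> / Z \<theta>) \<bullet> e) has_derivative
      (\<lambda>h. ((\<chi> i j. Z\<^sub>2 i j \<theta> / Z \<theta> - Z\<^sub>1 i \<theta> * Z\<^sub>1 j \<theta> / (Z \<theta>)\<^sup>2) *v h) \<bullet> e)) (at \<theta>)"
      unfolding row comp by (rule has_derivative_gradient_component[OF \<theta>])
  qed
  then show ?thesis
    \<comment> \<open>The gradient is known to equal the moment ratio only on the interior, so the
      derivative is transferred on this open set.\<close>
    by (rule has_derivative_transform_within_open[OF _ open_interior \<theta>])
       (simp add: gradient_log_partition)
qed

lemma hessian_log_partition:
  assumes \<theta>: "\<theta> \<in> interior (natural_parameter_space \<nu> b)"
  shows "hessian (log_partition \<nu> b) \<theta>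
    = (\<chi> i j. Z\<^sub>2 i j \<theta> / Z \<theta> - Z\<^sub>1 i \<theta> * Z\<^sub>1 j \<theta> / (Z \<theta>)\<^sup>2)"
  unfolding hessian_def frechet_derivative_at[OF has_derivative_gradient_log_partition[OF \<theta>], symmetric]
  by (rule matrix_of_matrix_vector_mul)

lemma isCont_exp_moment:
  assumes "subexponential g" "\<theta> \<in> interior (natural_parameter_space \<nu> b)"
  shows "isCont (exp_moment \<nu> b g) \<theta>"
  using has_derivative_exp_moment[OF assms] has_derivative_continuous by blast

text \<open>The Hessian is a rational expression in moments with a nonvanishing denominator, and
  each moment is continuous because it is differentiable.\<close>

lemma continuous_on_hessian_log_partition:
  "continuous_on (interior (natural_parameter_space \<nu> b)) (hessian (log_partition \<nu> b))"
proof -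
  have "continuous_on (interior (natural_parameter_space \<nu> b))
     (\<lambda>\<theta>. \<chi> i j. Z\<^sub>2 i j \<theta> / Z \<theta> - Z\<^sub>1 i \<theta> * Z\<^sub>1 j \<theta> / (Z \<theta>)\<^sup>2)"
  proof (intro continuous_on_vec_lambda continuous_on_diff continuous_on_divide continuous_on_mult
        continuous_on_power)
    have "Z \<theta> \<noteq> 0" if "\<theta> \<in> interior (natural_parameter_space \<nu> b)" for \<theta>
      using exp_moment_1_pos[of \<theta>] that interior_subset by fastforce
    then show "\<forall>\<theta>\<in>interior (natural_parameter_space \<nu> b). Z \<theta> \<noteq> 0"
      "\<forall>\<theta>\<in>interior (natural_parameter_space \<nu> b). (Z \<theta>)\<^sup>2 \<noteq> 0" by auto
  qed (rule continuous_at_imp_continuous_on, rule ballI, rule isCont_exp_moment,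
        intro subexponential_mult_component subexponential_1, assumption)+
  then show ?thesis
    by (rule continuous_on_eq) (simp add: hessian_log_partition)
qed

text \<open>Together with \<open>gradient_log_partition\<close> this identifies the gradient with
  the mean of the family, which is what centres the score.\<close>

lemma integral_nef_density:
  assumes \<theta>: "\<theta> \<in> interior (natural_parameter_space \<nu> b)"
  shows "(\<integral>y. nef_density \<nu> b \<theta> y * g y \<partial>\<nu>) = exp_moment \<nu> b g \<theta> / Z \<theta>"
    and "subexponential g \<Longrightarrow> integrable \<nu> (\<lambda>y. nef_density \<nu> b \<theta> y * g y)"
proof -
  have pos: "Z \<theta> > 0"
    using exp_moment_1_pos \<theta> interior_subset by blast
  have eq: "nef_density \<nu> b \<theta> y * g y = (g y * exp (y \<bullet> \<theta> + b y)) / Z \<theta>" for y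
    using pos by (simp add: nef_density_def log_partition_eq exp_diff exp_add algebra_simps)
  show "(\<integral>y. nef_density \<nu> b \<theta> y * g y \<partial>\<nu>) = exp_moment \<nu> b g \<theta> / Z \<theta>"
    unfolding eq by (simp add: exp_moment_def)
  show "integrable \<nu> (\<lambda>y. nef_density \<nu> b \<theta> y * g y)" if "subexponential g"
    unfolding eq by (intro integrable_divide integrable_subexponential that \<theta>)
qed

end

section \<open>The log-likelihood as a function of the coefficients\<close>

lemma norm_matrix_vector_mult_le:
  fixes A :: "real ^ 'n ^ 'm"
  shows "norm (A *v x) \<le> norm A * norm x"
proof -
  have "norm (A *v x) = L2_set (\<lambda>i. \<bar>A $ i \<bullet> x\<bar>) UNIV"
    by (simp add: norm_vec_def matrix_vector_mul_component)
  also have "\<dots> \<le> L2_set (\<lambda>i. norm (A $ i) * norm x) UNIV"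
    by (intro L2_set_mono Cauchy_Schwarz_ineq2) auto
  also have "\<dots> = norm A * norm x"
    by (simp add: norm_vec_def L2_set_left_distrib)
  finally show ?thesis .
qed

lemma abs_quadratic_form_le:
  fixes A :: "real ^ 'n ^ 'n"
  shows "\<bar>v \<bullet> (A *v v)\<bar> \<le> norm A * (norm v)\<^sup>2"
proof -
  have "\<bar>v \<bullet> (A *v v)\<bar> \<le> norm v * norm (A *v v)" by (rule Cauchy_Schwarz_ineq2)
  also have "\<dots> \<le> norm v * (norm A * norm v)"
    by (intro mult_left_mono norm_matrix_vector_mult_le) simp
  finally show ?thesis by (simp add: power2_eq_square mult_ac)
qed

locale glm_regressors =
  fixes \<nu> :: "(real ^ 'r) measure" and b :: "real ^ 'r \<Rightarrow> real"
    and \<X> :: "(real ^ 'p ^ 'r) set" and B :: "(real ^ 'p) set"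
  assumes family: "natural_exponential_family \<nu> b"
    and open_B: "open B" and convex_B: "convex B"
    and C1: "cond_C1 \<nu> b \<X> B"
begin

lemma sets_nu: "sets \<nu> = sets borel" and b_meas: "b \<in> borel_measurable borel"
  using family by (auto simp: natural_exponential_family_def)

lemma predictor_interior:
  "X \<in> \<X> \<Longrightarrow> \<beta> \<in> B \<Longrightarrow> X *v \<beta> \<in> interior (natural_parameter_space \<nu> b)"
  using C1 by (auto simp: cond_C1_def)

lemma compact_X: "compact \<X>"
  using C1 by (auto simp: cond_C1_def)

text \<open>The transposed regressor matrix applied to the mean of an observation with natural
  parameter \<open>X *v \<beta>\<close>. The score of an observation \<open>y\<close> is
  \<open>y v* X - mean_score X \<beta>\<close>.\<close>

definition mean_score :: "real ^ 'p ^ 'r \<Rightarrow> real ^ 'p \<Rightarrow> real ^ 'p" where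
  "mean_score X \<beta> = gradient (log_partition \<nu> b) (X *v \<beta>) v* X"

lemma has_derivative_log_partition_predictor:
  assumes "X \<in> \<X>" "\<beta> \<in> B"
  shows "((\<lambda>\<beta>. log_partition \<nu> b (X *v \<beta>)) has_derivative (\<lambda>h. mean_score X \<beta> \<bullet> h)) (at \<beta>)"
proof -
  note int = predictor_interior[OF assms]
  have "(log_partition \<nu> b has_derivative (\<lambda>h. gradient (log_partition \<nu> b) (X *v \<beta>) \<bullet> h)) (at (X *v \<beta>))"
    using has_derivative_log_partition[OF sets_nu b_meas int] gradient_log_partition[OF sets_nu b_meas int]
    by simp
  from has_derivative_compose[OF bounded_linear_imp_has_derivative[OF matrix_vector_mul_bounded_linear] this]
  show ?thesis by (simp add: mean_score_def dot_lmul_matrix)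
qed

lemma has_derivative_mean_score:
  assumes "X \<in> \<X>" "\<beta> \<in> B"
  shows "(mean_score X has_derivative (\<lambda>h. glm_info \<nu> b \<beta> X *v h)) (at \<beta>)"
proof -
  note int = predictor_interior[OF assms]
  have "(gradient (log_partition \<nu> b) has_derivative (\<lambda>h. hessian (log_partition \<nu> b) (X *v \<beta>) *v h))
      (at (X *v \<beta>))"
    using has_derivative_gradient_log_partition[OF sets_nu b_meas int]
      hessian_log_partition[OF sets_nu b_meas int] by simp
  from has_derivative_compose[OF bounded_linear_imp_has_derivative[OF matrix_vector_mul_bounded_linear] this]
  have "((\<lambda>\<beta>. transpose X *v gradient (log_partition \<nu> b) (X *v \<beta>)) has_derivative
      (\<lambda>h. transpose X *v (hessian (log_partition \<nu> b) (X *v \<beta>) *v (X *v h)))) (at \<beta>)"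
    by (rule bounded_linear.has_derivative[OF matrix_vector_mul_bounded_linear])
  then show ?thesis
    by (simp add: mean_score_def[abs_def] glm_info_def matrix_vector_mul_assoc matrix_mul_assoc
        del: transpose_matrix_vector flip: transpose_matrix_vector)
qed

text \<open>The form is that of the Hessian at \<open>X *v v\<close>. This vector may vanish for
  \<open>v \<noteq> 0\<close>, so a single regressor yields only semidefiniteness; definiteness has
  to come from (C2).\<close>

lemma quadratic_form_glm_info_nonneg:
  assumes "X \<in> \<X>" "\<beta> \<in> B"
  shows "v \<bullet> (glm_info \<nu> b \<beta> X *v v) \<ge> 0"
proof -
  have "positive_definite (hessian (log_partition \<nu> b) (X *v \<beta>))"
    using family predictor_interior[OF assms] by (auto simp: natural_exponential_family_def)
  then have "(X *v v) \<bullet> (hessian (log_partition \<nu> b) (X *v \<beta>) *v (X *v v)) \<ge> 0"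
    unfolding positive_definite_def by (cases "X *v v = 0") (auto intro: less_imp_le)
  moreover have "v \<bullet> (glm_info \<nu> b \<beta> X *v v)
      = (X *v v) \<bullet> (hessian (log_partition \<nu> b) (X *v \<beta>) *v (X *v v))"
    unfolding glm_info_def matrix_vector_mul_assoc[symmetric] transpose_matrix_vector
    by (metis dot_lmul_matrix inner_commute)
  ultimately show ?thesis by simp
qed

text \<open>Continuity has to be joint in regressor and coefficients: compactness of
  \<open>\<X>\<close> times a closed ball then makes the bounds below uniform over
  regressors.\<close>

lemma continuous_on_glm_info:
  "continuous_on (\<X> \<times> B) (\<lambda>(X, \<beta>). glm_info \<nu> b \<beta> X)"
proof -
  have predictor: "continuous_on (\<X> \<times> B) (\<lambda>z. fst z *v snd z)"
    unfolding matrix_vector_mult_def by (intro continuous_intros)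
  have H: "continuous_on (\<X> \<times> B) (\<lambda>z. hessian (log_partition \<nu> b) (fst z *v snd z))"
    by (rule continuous_on_compose2[OF continuous_on_hessian_log_partition[OF sets_nu b_meas] predictor])
       (auto intro: predictor_interior)
  show ?thesis
    unfolding case_prod_beta glm_info_def matrix_matrix_mult_def transpose_def
    using H by (auto intro!: continuous_intros)
qed

section \<open>Expansions along segments, uniform in the regressor\<close>

lemma has_real_derivative_along_line:
  assumes X: "X \<in> \<X>" and "\<beta> + t *\<^sub>R d \<in> B"
  shows "((\<lambda>t. log_partition \<nu> b (X *v (\<beta> + t *\<^sub>R d))) has_real_derivative
            mean_score X (\<beta> + t *\<^sub>R d) \<bullet> d) (at t)"
    and "((\<lambda>t. mean_score X (\<beta> + t *\<^sub>R d) \<bullet> d) has_real_derivative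
            d \<bullet> (glm_info \<nu> b (\<beta> + t *\<^sub>R d) X *v d)) (at t)"
proof -
  have line: "((\<lambda>t. \<beta> + t *\<^sub>R d) has_derivative (\<lambda>h. h *\<^sub>R d)) (at t)"
    by (auto intro!: derivative_eq_intros)
  have scale: "A *v (h *\<^sub>R d) = h *\<^sub>R (A *v d)" for A :: "real ^ 'p ^ 'p" and h
    by (rule linear_cmul[OF matrix_vector_mul_linear])
  show "((\<lambda>t. log_partition \<nu> b (X *v (\<beta> + t *\<^sub>R d))) has_real_derivative
            mean_score X (\<beta> + t *\<^sub>R d) \<bullet> d) (at t)"
    using has_derivative_compose[OF line has_derivative_log_partition_predictor[OF assms]]
    by (simp add: has_field_derivative_def fun_eq_iff mult.commute[of _ "mean_score X (\<beta> + t *\<^sub>R d) \<bullet> d"])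
  have "((\<lambda>t. mean_score X (\<beta> + t *\<^sub>R d) \<bullet> d) has_derivative
      (\<lambda>h. (glm_info \<nu> b (\<beta> + t *\<^sub>R d) X *v (h *\<^sub>R d)) \<bullet> d)) (at t)"
    by (rule has_derivative_inner_left[OF has_derivative_compose[OF line has_derivative_mean_score[OF assms]]])
  then show "((\<lambda>t. mean_score X (\<beta> + t *\<^sub>R d) \<bullet> d) has_real_derivative
            d \<bullet> (glm_info \<nu> b (\<beta> + t *\<^sub>R d) X *v d)) (at t)"
    unfolding scale has_field_derivative_def
    by (simp add: inner_commute[of d] mult.commute[of _ "_ \<bullet> d"])
qed

lemma segment_in_B:
  assumes "u \<in> B" "v \<in> B" "0 \<le> t" "t \<le> 1"
  shows "u + t *\<^sub>R (v - u) \<in> B"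
  using convexD_alt[OF convex_B assms(1,2,3,4)] by (simp add: algebra_simps)

lemma convex_on_log_partition_predictor:
  assumes X: "X \<in> \<X>"
  shows "convex_on B (\<lambda>\<beta>. log_partition \<nu> b (X *v \<beta>))"
proof (rule convex_onI)
  fix t :: real and u v assume t: "0 < t" "t < 1" and uv: "u \<in> B" "v \<in> B"
  have "convex_on {0..1} (\<lambda>t. log_partition \<nu> b (X *v (u + t *\<^sub>R (v - u))))"
  proof (rule f''_ge0_imp_convex)
    fix s :: real assume "s \<in> {0..1}"
    then have s: "u + s *\<^sub>R (v - u) \<in> B" using segment_in_B[OF uv] by simp
    show "DERIV (\<lambda>t. log_partition \<nu> b (X *v (u + t *\<^sub>R (v - u)))) s
        :> mean_score X (u + s *\<^sub>R (v - u)) \<bullet> (v - u)"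
      "DERIV (\<lambda>t. mean_score X (u + t *\<^sub>R (v - u)) \<bullet> (v - u)) s
        :> (v - u) \<bullet> (glm_info \<nu> b (u + s *\<^sub>R (v - u)) X *v (v - u))"
      by (rule has_real_derivative_along_line[OF X s])+
    show "(v - u) \<bullet> (glm_info \<nu> b (u + s *\<^sub>R (v - u)) X *v (v - u)) \<ge> 0"
      by (rule quadratic_form_glm_info_nonneg[OF X s])
  qed auto
  from convex_onD[OF this, of t 0 1] t
  show "log_partition \<nu> b (X *v ((1 - t) *\<^sub>R u + t *\<^sub>R v))
      \<le> (1 - t) * log_partition \<nu> b (X *v u) + t * log_partition \<nu> b (X *v v)"
    by (simp add: algebra_simps)
qed (rule convex_B)

lemma log_partition_predictor_second_order:
  assumes X: "X \<in> \<X>" and u: "u \<in> B" and v: "v \<in> B"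
  obtains s where "0 < s" "s < 1"
    "log_partition \<nu> b (X *v v) = log_partition \<nu> b (X *v u) + mean_score X u \<bullet> (v - u)
       + (v - u) \<bullet> (glm_info \<nu> b (u + s *\<^sub>R (v - u)) X *v (v - u)) / 2"
proof -
  define d where "d = v - u"
  define D where "D m = (if m = 0 then (\<lambda>t. log_partition \<nu> b (X *v (u + t *\<^sub>R d)))
    else if m = 1 then (\<lambda>t. mean_score X (u + t *\<^sub>R d) \<bullet> d)
    else (\<lambda>t. d \<bullet> (glm_info \<nu> b (u + t *\<^sub>R d) X *v d)))" for m :: nat
  have "\<exists>s. 0 < s \<and> s < 1 \<and> D 0 1 = (\<Sum>m<2. (D m 0 / fact m) * (1 - 0) ^ m) + (D 2 s / fact 2) * (1 - 0)\<^sup>2"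
  proof (rule Taylor_up)
    show "\<forall>m t. m < 2 \<and> 0 \<le> t \<and> t \<le> 1 \<longrightarrow> DERIV (D m) t :> D (Suc m) t"
    proof (intro allI impI)
      fix m :: nat and t :: real assume *: "m < 2 \<and> 0 \<le> t \<and> t \<le> 1"
      then have "u + t *\<^sub>R d \<in> B" unfolding d_def by (intro segment_in_B u v) auto
      from has_real_derivative_along_line[OF X this] *
      show "DERIV (D m) t :> D (Suc m) t" by (auto simp: D_def less_2_cases_iff)
    qed
  qed auto
  then obtain s where "0 < s" "s < 1" "D 0 1 = D 0 0 + D 1 0 + D 2 s / 2"
    by (auto simp: numeral_2_eq_2)
  then show thesis using that[of s] by (simp add: D_def d_def)
qed

text \<open>The Taylor remainder involves \<open>glm_info\<close> at an intermediate point that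
  varies with \<open>X\<close>. Uniform continuity on a compact product replaces it by the value at
  \<open>\<beta>\<^sub>0\<close>, where (C2) controls the averages, at the price of the error with
  \<open>\<epsilon>\<close>.\<close>

lemma uniform_quadratic_lower_bound:
  assumes \<beta>\<^sub>0: "\<beta>\<^sub>0 \<in> B" and \<epsilon>: "\<epsilon> > 0"
  obtains r where "r > 0" "cball \<beta>\<^sub>0 r \<subseteq> B"
    "\<And>X \<beta>. X \<in> \<X> \<Longrightarrow> \<beta> \<in> cball \<beta>\<^sub>0 r \<Longrightarrow>
       log_partition \<nu> b (X *v \<beta>) \<ge> log_partition \<nu> b (X *v \<beta>\<^sub>0) + mean_score X \<beta>\<^sub>0 \<bullet> (\<beta> - \<beta>\<^sub>0)
         + (\<beta> - \<beta>\<^sub>0) \<bullet> (glm_info \<nu> b \<beta>\<^sub>0 X *v (\<beta> - \<beta>\<^sub>0)) / 2 - \<epsilon> * (norm (\<beta> - \<beta>\<^sub>0))\<^sup>2"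
proof -
  obtain r\<^sub>0 where r\<^sub>0: "r\<^sub>0 > 0" "cball \<beta>\<^sub>0 r\<^sub>0 \<subseteq> B"
    using open_B \<beta>\<^sub>0 by (auto simp: open_contains_cball)
  let ?K = "\<X> \<times> cball \<beta>\<^sub>0 r\<^sub>0"
  have "uniformly_continuous_on ?K (\<lambda>(X, \<beta>). glm_info \<nu> b \<beta> X)"
    by (rule compact_uniformly_continuous[OF continuous_on_subset[OF continuous_on_glm_info]])
       (use r\<^sub>0 compact_X in \<open>auto intro: compact_Times\<close>)
  then obtain d where d: "d > 0" and close: "\<And>z z'. z \<in> ?K \<Longrightarrow> z' \<in> ?K \<Longrightarrow> dist z' z < d \<Longrightarrow>
      dist ((\<lambda>(X, \<beta>). glm_info \<nu> b \<beta> X) z') ((\<lambda>(X, \<beta>). glm_info \<nu> b \<beta> X) z) < \<epsilon>"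
    using \<epsilon> unfolding uniformly_continuous_on_def by metis
  define r where "r = min r\<^sub>0 (d / 2)"
  have r: "r > 0" "r < d" "r \<le> r\<^sub>0" using r\<^sub>0 d by (auto simp: r_def)
  have sub: "cball \<beta>\<^sub>0 r \<subseteq> B" using r r\<^sub>0 by auto
  have "log_partition \<nu> b (X *v \<beta>) \<ge> log_partition \<nu> b (X *v \<beta>\<^sub>0) + mean_score X \<beta>\<^sub>0 \<bullet> (\<beta> - \<beta>\<^sub>0)
         + (\<beta> - \<beta>\<^sub>0) \<bullet> (glm_info \<nu> b \<beta>\<^sub>0 X *v (\<beta> - \<beta>\<^sub>0)) / 2 - \<epsilon> * (norm (\<beta> - \<beta>\<^sub>0))\<^sup>2"
    if X: "X \<in> \<X>" and \<beta>: "\<beta> \<in> cball \<beta>\<^sub>0 r" for X \<beta>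
  proof -
    define v where "v = \<beta> - \<beta>\<^sub>0"
    obtain s where s: "0 < s" "s < 1"
      "log_partition \<nu> b (X *v \<beta>) = log_partition \<nu> b (X *v \<beta>\<^sub>0) + mean_score X \<beta>\<^sub>0 \<bullet> v
        + v \<bullet> (glm_info \<nu> b (\<beta>\<^sub>0 + s *\<^sub>R v) X *v v) / 2"
      using log_partition_predictor_second_order[OF X \<beta>\<^sub>0 subsetD[OF sub \<beta>]] unfolding v_def by blast
    have nv: "norm v \<le> r" using \<beta> by (simp add: v_def dist_norm norm_minus_commute)
    have "norm (s *\<^sub>R v) \<le> norm v" using s by (simp add: mult_left_le_one_le)
    then have sv: "norm (s *\<^sub>R v) \<le> r" using nv by linarith
    have "dist ((\<lambda>(X, \<beta>). glm_info \<nu> b \<beta> X) (X, \<beta>\<^sub>0 + s *\<^sub>R v)) ((\<lambda>(X, \<beta>). glm_info \<nu> b \<beta> X) (X, \<beta>\<^sub>0)) < \<epsilon>"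
      by (rule close) (use X sv r r\<^sub>0 in \<open>auto simp: dist_norm dist_Pair_Pair\<close>)
    then have *: "norm (glm_info \<nu> b (\<beta>\<^sub>0 + s *\<^sub>R v) X - glm_info \<nu> b \<beta>\<^sub>0 X) \<le> \<epsilon>"
      by (simp add: dist_norm)
    have "\<bar>v \<bullet> (glm_info \<nu> b (\<beta>\<^sub>0 + s *\<^sub>R v) X *v v) - v \<bullet> (glm_info \<nu> b \<beta>\<^sub>0 X *v v)\<bar> \<le> \<epsilon> * (norm v)\<^sup>2"
      using order_trans[OF abs_quadratic_form_le mult_right_mono[OF *]]
      by (simp add: matrix_vector_mult_diff_rdistrib inner_diff_right)
    \<comment> \<open>The error is weakened by a factor 2 so that halving the quadratic term leaves
      exactly the claimed one.\<close>
    then have "v \<bullet> (glm_info \<nu> b (\<beta>\<^sub>0 + s *\<^sub>R v) X *v v) \<ge> v \<bullet> (glm_info \<nu> b \<beta>\<^sub>0 X *v v) - 2 * (\<epsilon> * (norm v)\<^sup>2)"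
      using mult_nonneg_nonneg[of \<epsilon> "(norm v)\<^sup>2"] \<epsilon> by simp
    then show ?thesis unfolding v_def[symmetric] s(3) by simp
  qed
  with r sub that show thesis by blast
qed

text \<open>Bounded information makes the mean score Lipschitz, so on a ball of radius
  \<open>\<rho>\<close> it deviates from its value at the centre by at most
  \<open>C * \<rho>\<close>. Linearizing at \<open>\<beta>\<^sub>0\<close> rather than at
  \<open>v\<close> keeps the true score as the slope, and the factor \<open>\<rho>\<close> makes the
  total error over n observations no larger in order than the score once \<open>\<rho>\<close> is of
  order n^(-1/2).\<close>

lemma uniform_linearization_bound:
  assumes r: "cball \<beta>\<^sub>0 r \<subseteq> B" and \<beta>\<^sub>0: "\<beta>\<^sub>0 \<in> B"
  obtains C where "C \<ge> 0"
    "\<And>X \<rho> u v. X \<in> \<X> \<Longrightarrow> \<rho> \<le> r \<Longrightarrow> u \<in> cball \<beta>\<^sub>0 \<rho> \<Longrightarrow> v \<in> cball \<beta>\<^sub>0 \<rho> \<Longrightarrow>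
       \<bar>log_partition \<nu> b (X *v u) - log_partition \<nu> b (X *v v) - mean_score X \<beta>\<^sub>0 \<bullet> (u - v)\<bar>
         \<le> C * \<rho> * norm (u - v)"
proof -
  let ?K = "\<X> \<times> cball \<beta>\<^sub>0 r"
  have "compact ((\<lambda>(X, \<beta>). glm_info \<nu> b \<beta> X) ` ?K)"
    by (rule compact_continuous_image[OF continuous_on_subset[OF continuous_on_glm_info]])
       (use r compact_X in \<open>auto intro: compact_Times\<close>)
  then obtain C where "\<forall>A \<in> (\<lambda>(X, \<beta>). glm_info \<nu> b \<beta> X) ` ?K. norm A \<le> C"
    using compact_imp_bounded bounded_iff by metis
  then have C: "norm (glm_info \<nu> b \<beta> X) \<le> max 0 C" if "X \<in> \<X>" "\<beta> \<in> cball \<beta>\<^sub>0 r" for X \<beta>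
    using that by force
  have "\<bar>log_partition \<nu> b (X *v u) - log_partition \<nu> b (X *v v) - mean_score X \<beta>\<^sub>0 \<bullet> (u - v)\<bar>
         \<le> max 0 C * \<rho> * norm (u - v)"
    if X: "X \<in> \<X>" and \<rho>: "\<rho> \<le> r" and u: "u \<in> cball \<beta>\<^sub>0 \<rho>" and v: "v \<in> cball \<beta>\<^sub>0 \<rho>" for X \<rho> u v
  proof -
    have sub: "cball \<beta>\<^sub>0 \<rho> \<subseteq> cball \<beta>\<^sub>0 r" using \<rho> by (rule subset_cball)
    have \<rho>0: "\<rho> \<ge> 0" using u zero_le_dist[of \<beta>\<^sub>0 u] unfolding mem_cball by linarith
    have center: "\<beta>\<^sub>0 \<in> cball \<beta>\<^sub>0 \<rho>" using \<rho>0 by simp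
    have score: "norm (mean_score X \<beta> - mean_score X \<beta>\<^sub>0) \<le> max 0 C * \<rho>" if \<beta>: "\<beta> \<in> cball \<beta>\<^sub>0 \<rho>" for \<beta>
    proof -
      have "norm (mean_score X \<beta> - mean_score X \<beta>\<^sub>0) \<le> max 0 C * norm (\<beta> - \<beta>\<^sub>0)"
      proof (rule differentiable_bound[OF convex_cball _ _ \<beta> center])
        fix \<xi> assume \<xi>: "\<xi> \<in> cball \<beta>\<^sub>0 \<rho>"
        show "(mean_score X has_derivative (\<lambda>h. glm_info \<nu> b \<xi> X *v h)) (at \<xi> within cball \<beta>\<^sub>0 \<rho>)"
          using has_derivative_mean_score[OF X] \<xi> sub r by (blast intro: has_derivative_at_withinI)
        show "onorm (\<lambda>h. glm_info \<nu> b \<xi> X *v h) \<le> max 0 C"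
          using order_trans[OF norm_matrix_vector_mult_le mult_right_mono[OF C[OF X]]] \<xi> sub
          by (intro onorm_bound) auto
      qed
      also have "\<dots> \<le> max 0 C * \<rho>"
        using \<beta> by (intro mult_left_mono) (auto simp: dist_norm norm_minus_commute)
      finally show ?thesis .
    qed
    have "norm (log_partition \<nu> b (X *v u) - log_partition \<nu> b (X *v v) - mean_score X \<beta>\<^sub>0 \<bullet> (u - v))
        \<le> norm (u - v) * (max 0 C * \<rho>)"
    proof (rule differentiable_bound_linearization[OF _ _ _ center,
          where f' = "\<lambda>\<beta> h. mean_score X \<beta> \<bullet> h"])
      show "v + t *\<^sub>R (u - v) \<in> cball \<beta>\<^sub>0 \<rho>" if "t \<in> {0..1}" for t
        using convexD_alt[OF convex_cball v u, of t] that by (simp add: algebra_simps)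
      fix \<xi> assume \<xi>: "\<xi> \<in> cball \<beta>\<^sub>0 \<rho>"
      show "((\<lambda>\<beta>. log_partition \<nu> b (X *v \<beta>)) has_derivative (\<lambda>h. mean_score X \<xi> \<bullet> h)) (at \<xi> within cball \<beta>\<^sub>0 \<rho>)"
        using has_derivative_log_partition_predictor[OF X] \<xi> sub r by (blast intro: has_derivative_at_withinI)
      show "onorm ((\<lambda>h. mean_score X \<xi> \<bullet> h) - (\<lambda>h. mean_score X \<beta>\<^sub>0 \<bullet> h)) \<le> max 0 C * \<rho>"
      proof (rule onorm_bound)
        fix h
        have "norm (((\<lambda>h. mean_score X \<xi> \<bullet> h) - (\<lambda>h. mean_score X \<beta>\<^sub>0 \<bullet> h)) h)
            = \<bar>(mean_score X \<xi> - mean_score X \<beta>\<^sub>0) \<bullet> h\<bar>" by (simp add: inner_diff_left)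
        also have "\<dots> \<le> norm (mean_score X \<xi> - mean_score X \<beta>\<^sub>0) * norm h" by (rule Cauchy_Schwarz_ineq2)
        also have "\<dots> \<le> max 0 C * \<rho> * norm h" by (intro mult_right_mono score \<xi>) simp
        finally show "norm (((\<lambda>h. mean_score X \<xi> \<bullet> h) - (\<lambda>h. mean_score X \<beta>\<^sub>0 \<bullet> h)) h) \<le> max 0 C * \<rho> * norm h" .
      qed (use \<rho>0 in simp)
    qed
    then show ?thesis by (simp add: mult_ac)
  qed
  then show thesis using that[of "max 0 C"] by simp
qed

end

section \<open>Penalized convex minimization\<close>

text \<open>The minimizer is confined to the ball by convexity of \<open>f\<close>, then to radius \<open>\<sigma> / (n * c)\<close>
  because the penalty is flat near the nonzero coordinates of \<open>\<beta>\<^sub>0\<close>; at that scale, setting the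
  spurious coordinates to zero lowers the penalty by more than it raises \<open>f\<close>.\<close>

lemma penalized_convex_argmin_support:
  fixes f :: "real ^ 'p \<Rightarrow> real" and h :: "real \<Rightarrow> real" and \<beta>\<^sub>0 s :: "real ^ 'p" and n :: real
  defines "Q \<equiv> \<lambda>\<beta>. f \<beta> + n * (\<Sum>j\<in>UNIV. h (\<beta> $ j))"
  assumes B: "open B" "convex_on B f"
    and pos: "n > 0" "c > 0" "C \<ge> 0" "r > 0" "m > 0"
    and ball: "cball \<beta>\<^sub>0 r \<subseteq> B"
    and quad: "\<And>\<beta>. \<beta> \<in> cball \<beta>\<^sub>0 r \<Longrightarrow> f \<beta> \<ge> f \<beta>\<^sub>0 + s \<bullet> (\<beta> - \<beta>\<^sub>0) + n * c * (norm (\<beta> - \<beta>\<^sub>0))\<^sup>2"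
    and lin: "\<And>\<rho> u v. \<rho> \<le> r \<Longrightarrow> u \<in> cball \<beta>\<^sub>0 \<rho> \<Longrightarrow> v \<in> cball \<beta>\<^sub>0 \<rho> \<Longrightarrow>
                f u - f v \<le> (norm s + n * C * \<rho>) * norm (u - v)"
    and score: "norm s \<le> \<sigma>"
    and h: "continuous_on UNIV h" "h 0 = 0" "\<And>t. h t \<ge> 0"
    and flat: "\<And>t t'. m \<le> \<bar>t\<bar> \<Longrightarrow> m \<le> \<bar>t'\<bar> \<Longrightarrow> h t = h t'"
    and support: "\<And>j. \<beta>\<^sub>0 $ j \<noteq> 0 \<Longrightarrow> m + r \<le> \<bar>\<beta>\<^sub>0 $ j\<bar>"
    and outer: "\<sigma> * r + n * (\<Sum>j\<in>UNIV. h (\<beta>\<^sub>0 $ j)) < n * c * r\<^sup>2"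
    and inner: "\<And>t. t \<noteq> 0 \<Longrightarrow> \<bar>t\<bar> \<le> \<sigma> / (n * c) \<Longrightarrow> (\<sigma> + C * \<sigma> / c) * \<bar>t\<bar> < n * h t"
  shows "\<exists>\<beta>. is_arg_min Q (\<lambda>\<beta>. \<beta> \<in> B) \<beta>"
    and "\<And>\<beta>. is_arg_min Q (\<lambda>\<beta>. \<beta> \<in> B) \<beta> \<Longrightarrow> {j. \<beta> $ j \<noteq> 0} = {j. \<beta>\<^sub>0 $ j \<noteq> 0}"
proof -
  have \<beta>\<^sub>0: "\<beta>\<^sub>0 \<in> B" using ball pos by auto
  have score_ge: "s \<bullet> v \<ge> - \<sigma> * norm v" for v
  proof -
    have "- (s \<bullet> v) \<le> norm s * norm v" using norm_cauchy_schwarz[of "- s" v] by simp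
    also have "\<dots> \<le> \<sigma> * norm v" by (intro mult_right_mono score) simp
    finally show ?thesis by simp
  qed
  have far: "Q \<beta> > Q \<beta>\<^sub>0" if \<beta>: "\<beta> \<in> B" "\<beta> \<notin> cball \<beta>\<^sub>0 r" for \<beta>
  proof -
    define d where "d = norm (\<beta> - \<beta>\<^sub>0)"
    define t where "t = r / d"
    \<comment> \<open>The point where the segment towards \<open>\<beta>\<close> crosses the sphere.
      The quadratic growth is available at \<open>p\<close>, and convexity of \<open>f\<close>
      carries it outward to \<open>\<beta>\<close>; of the penalty at \<open>\<beta>\<close> only
      nonnegativity is used.\<close>
    define p where "p = \<beta>\<^sub>0 + t *\<^sub>R (\<beta> - \<beta>\<^sub>0)"
    have d: "d > r" using \<beta>(2) by (simp add: d_def dist_norm norm_minus_commute)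
    have t: "0 < t" "t < 1" "t * d = r" using d pos by (auto simp: t_def)
    have np: "norm (p - \<beta>\<^sub>0) = r" using t by (simp add: p_def d_def[symmetric])
    then have "f \<beta>\<^sub>0 + s \<bullet> (p - \<beta>\<^sub>0) + n * c * r\<^sup>2 \<le> f p"
      using quad[of p] by (simp add: dist_norm norm_minus_commute)
    moreover have "s \<bullet> (p - \<beta>\<^sub>0) \<ge> - \<sigma> * r" using score_ge[of "p - \<beta>\<^sub>0"] np by simp
    moreover have "f p \<le> (1 - t) * f \<beta>\<^sub>0 + t * f \<beta>"
      using convex_onD[OF B(2), of t \<beta>\<^sub>0 \<beta>] t \<beta>\<^sub>0 \<beta> by (simp add: p_def algebra_simps)
    ultimately have g: "n * c * r\<^sup>2 - \<sigma> * r \<le> t * (f \<beta> - f \<beta>\<^sub>0)" by (simp add: algebra_simps)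
    have S0: "n * (\<Sum>j\<in>UNIV. h (\<beta>\<^sub>0 $ j)) \<ge> 0" and S: "n * (\<Sum>j\<in>UNIV. h (\<beta> $ j)) \<ge> 0"
      using pos h by (auto intro!: mult_nonneg_nonneg sum_nonneg)
    have "t * (f \<beta> - f \<beta>\<^sub>0) > 0" using g outer S0 by linarith
    then have "f \<beta> - f \<beta>\<^sub>0 > 0" using t by (simp add: zero_less_mult_iff)
    then have "t * (f \<beta> - f \<beta>\<^sub>0) \<le> f \<beta> - f \<beta>\<^sub>0" using t by (simp add: mult_left_le_one_le)
    then show ?thesis using g outer S unfolding Q_def by linarith
  qed
  show "\<exists>\<beta>. is_arg_min Q (\<lambda>\<beta>. \<beta> \<in> B) \<beta>"
  proof -
    have "continuous_on (cball \<beta>\<^sub>0 r) f"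
      using convex_on_continuous[OF B(1) B(2)] ball continuous_on_subset by blast
    moreover have "continuous_on (cball \<beta>\<^sub>0 r) (\<lambda>\<beta>. h (\<beta> $ j))" for j
      by (rule continuous_on_compose2[OF h(1)]) (auto intro!: continuous_intros)
    ultimately have "continuous_on (cball \<beta>\<^sub>0 r) Q"
      unfolding Q_def by (intro continuous_intros) auto
    then obtain \<beta>\<^sub>1 where \<beta>\<^sub>1: "\<beta>\<^sub>1 \<in> cball \<beta>\<^sub>0 r" "\<And>\<beta>. \<beta> \<in> cball \<beta>\<^sub>0 r \<Longrightarrow> Q \<beta>\<^sub>1 \<le> Q \<beta>"
      using continuous_attains_inf[of "cball \<beta>\<^sub>0 r" Q] pos by auto
    have "\<not> Q \<beta> < Q \<beta>\<^sub>1" if "\<beta> \<in> B" for \<beta>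
      \<comment> \<open>A minimizer over the compact ball is global, because \<open>far\<close>
        beats every outside point already with the value at the centre.\<close>
      using far[OF that] \<beta>\<^sub>1(2)[of \<beta>] \<beta>\<^sub>1(2)[of \<beta>\<^sub>0] pos by (cases "\<beta> \<in> cball \<beta>\<^sub>0 r") auto
    then show ?thesis using \<beta>\<^sub>1(1) ball unfolding is_arg_min_def by blast
  qed
  fix \<beta> assume "is_arg_min Q (\<lambda>\<beta>. \<beta> \<in> B) \<beta>"
  then have \<beta>: "\<beta> \<in> B" and min: "\<And>u. u \<in> B \<Longrightarrow> Q \<beta> \<le> Q u"
    by (auto simp: is_arg_min_def not_less)
  define \<rho> where "\<rho> = norm (\<beta> - \<beta>\<^sub>0)"
  have in_ball: "\<beta> \<in> cball \<beta>\<^sub>0 r" using far[OF \<beta>] min[OF \<beta>\<^sub>0] by auto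
  then have \<rho>: "\<rho> \<le> r" "\<rho> \<ge> 0" by (auto simp: \<rho>_def dist_norm norm_minus_commute)
  \<comment> \<open>True coordinates start at distance at least \<open>m + r\<close> from zero and
    move by at most \<open>r\<close>, so they never leave the flat region.\<close>
  have large: "m \<le> \<bar>\<beta> $ j\<bar>" "m \<le> \<bar>\<beta>\<^sub>0 $ j\<bar>" if "\<beta>\<^sub>0 $ j \<noteq> 0" for j
    using support[OF that] component_le_norm_cart[of "\<beta> - \<beta>\<^sub>0" j] \<rho> pos by (auto simp: \<rho>_def)
  \<comment> \<open>Equality by flatness on the support, and \<open>h 0 = 0 \<le> h\<close> off it.
    The centre thus pays no more penalty than the minimizer, so minimality compares the values of
    \<open>f\<close> alone.\<close>
  have "h (\<beta>\<^sub>0 $ j) \<le> h (\<beta> $ j)" for j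
    using flat[OF large, of j j] h by (cases "\<beta>\<^sub>0 $ j = 0") auto
  then have "(\<Sum>j\<in>UNIV. h (\<beta>\<^sub>0 $ j)) \<le> (\<Sum>j\<in>UNIV. h (\<beta> $ j))" by (rule sum_mono)
  then have "n * (\<Sum>j\<in>UNIV. h (\<beta>\<^sub>0 $ j)) \<le> n * (\<Sum>j\<in>UNIV. h (\<beta> $ j))"
    using pos by (intro mult_left_mono) auto
  then have "f \<beta> \<le> f \<beta>\<^sub>0" using min[OF \<beta>\<^sub>0] unfolding Q_def by linarith
  then have "n * c * \<rho>\<^sup>2 \<le> \<sigma> * \<rho>"
    using quad[OF in_ball] score_ge[of "\<beta> - \<beta>\<^sub>0"] unfolding \<rho>_def by linarith
  then have n\<rho>: "n * c * \<rho> \<le> \<sigma>"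
  proof (cases "\<rho> = 0")
    case True
    then show ?thesis using score norm_ge_zero[of s] by (simp only: mult_zero_right)
  next
    case False
    then have "\<rho> > 0" using \<rho>(2) by simp
    moreover have "n * c * \<rho> * \<rho> \<le> \<sigma> * \<rho>"
      using \<open>n * c * \<rho>\<^sup>2 \<le> \<sigma> * \<rho>\<close> by (simp add: power2_eq_square mult.assoc)
    ultimately show ?thesis by (rule mult_right_le_imp_le[rotated])
  qed
  have "\<beta> $ j = 0" if j: "\<beta>\<^sub>0 $ j = 0" for j
  proof (rule ccontr)
    assume nz: "\<beta> $ j \<noteq> 0"
    \<comment> \<open>The competitor: it is coordinatewise no farther from
      \<open>\<beta>\<^sub>0\<close> than \<open>\<beta>\<close>, so it lies in the same ball of
      radius \<open>\<rho>\<close> and \<open>lin\<close> applies with this small radius.\<close>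
    define u where "u = (\<chi> j. if \<beta>\<^sub>0 $ j = 0 then 0 else \<beta> $ j)"
    have "norm (u - \<beta>\<^sub>0) \<le> \<rho>"
      unfolding \<rho>_def by (rule norm_le_componentwise_cart) (simp add: u_def)
    then have u: "u \<in> cball \<beta>\<^sub>0 \<rho>" by (simp add: dist_norm norm_minus_commute)
    have \<beta>\<rho>: "\<beta> \<in> cball \<beta>\<^sub>0 \<rho>" by (simp add: \<rho>_def dist_norm norm_minus_commute)
    have uB: "u \<in> B" using u \<rho> ball by auto
    \<comment> \<open>The bound on the slope of \<open>f\<close> in that ball after inserting
      \<open>n * \<rho> \<le> \<sigma> / c\<close>.\<close>
    define \<kappa> where "\<kappa> = \<sigma> + C * \<sigma> / c"
    have \<kappa>: "norm s + n * C * \<rho> \<le> \<kappa>" 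
    proof -
      have "n * \<rho> \<le> \<sigma> / c" using n\<rho> pos by (simp add: field_simps)
      then have "C * (n * \<rho>) \<le> C * (\<sigma> / c)" using pos by (intro mult_left_mono) auto
      then show ?thesis using score by (simp add: \<kappa>_def mult_ac)
    qed
    have "norm s + n * C * \<rho> \<ge> 0" using pos \<rho> by simp
    then have \<kappa>0: "\<kappa> \<ge> 0" using \<kappa> by linarith
    have "f u - f \<beta> \<le> (norm s + n * C * \<rho>) * norm (u - \<beta>)" by (rule lin[OF \<rho>(1) u \<beta>\<rho>])
    \<comment> \<open>Passing to the l1 norm decouples the coordinates: \<open>inner\<close> gives a
      strict gain at every nonzero spurious coordinate, and all others contribute zero on both
      sides.\<close>
    also have "\<dots> \<le> \<kappa> * (\<Sum>j\<in>UNIV. \<bar>(u - \<beta>) $ j\<bar>)"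
      by (intro mult_mono \<kappa> norm_le_l1_cart \<kappa>0) auto
    also have "\<dots> < (\<Sum>j\<in>UNIV. n * h (\<beta> $ j) - n * h (u $ j))"
      unfolding sum_distrib_left
    proof (rule sum_strict_mono_ex1)
      have less: "\<kappa> * \<bar>(u - \<beta>) $ i\<bar> < n * h (\<beta> $ i) - n * h (u $ i)"
        if i: "\<beta>\<^sub>0 $ i = 0" "\<beta> $ i \<noteq> 0" for i
      proof -
        have "\<bar>\<beta> $ i\<bar> \<le> \<rho>" using component_le_norm_cart[of "\<beta> - \<beta>\<^sub>0" i] i by (simp add: \<rho>_def)
        also have "\<dots> \<le> \<sigma> / (n * c)" using n\<rho> pos by (simp add: field_simps)
        finally show ?thesis using inner[OF i(2)] i h by (simp add: u_def \<kappa>_def)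
      qed
      show "\<forall>i\<in>UNIV. \<kappa> * \<bar>(u - \<beta>) $ i\<bar> \<le> n * h (\<beta> $ i) - n * h (u $ i)"
      proof
        fix i
        show "\<kappa> * \<bar>(u - \<beta>) $ i\<bar> \<le> n * h (\<beta> $ i) - n * h (u $ i)"
        proof (cases "\<beta>\<^sub>0 $ i = 0 \<and> \<beta> $ i \<noteq> 0")
          case True then show ?thesis using less by (simp add: less_imp_le)
        next
          case False then show ?thesis using h by (auto simp: u_def)
        qed
      qed
      show "\<exists>i\<in>UNIV. \<kappa> * \<bar>(u - \<beta>) $ i\<bar> < n * h (\<beta> $ i) - n * h (u $ i)"
        using less[OF j nz] by blast
    qed simp
    finally have "Q u < Q \<beta>"
      by (simp add: Q_def sum_subtractf sum_distrib_left)
    then show False using min[OF uB] by simp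
  qed
  moreover have "\<beta> $ j \<noteq> 0" if "\<beta>\<^sub>0 $ j \<noteq> 0" for j using large(1)[OF that] pos by auto
  ultimately show "{j. \<beta> $ j \<noteq> 0} = {j. \<beta>\<^sub>0 $ j \<noteq> 0}" by blast
qed

lemma even_mono_deriv_zero_imp_flat:
  fixes h :: "real \<Rightarrow> real"
  assumes diff: "\<And>t. t \<noteq> 0 \<Longrightarrow> h differentiable (at t)"
    and even: "\<And>t. h (- t) = h t"
    and zero: "\<And>t. m \<le> \<bar>t\<bar> \<Longrightarrow> deriv h t = 0"
    and m: "m > 0" and t: "m \<le> \<bar>t\<bar>"
  shows "h t = h m"
proof -
  have "h \<bar>t\<bar> = h m"
  proof (cases "\<bar>t\<bar> = m")
    case False
    have deriv: "(h has_real_derivative 0) (at x)" if "m \<le> x" for x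
      using DERIV_deriv_iff_real_differentiable[THEN iffD2, OF diff[of x]] zero[of x] that m by simp
    show ?thesis
    proof (rule DERIV_isconst_end[of m "\<bar>t\<bar>" h])
      show "m < \<bar>t\<bar>" using t False by simp
      show "continuous_on {m..\<bar>t\<bar>} h"
        using deriv by (intro continuous_at_imp_continuous_on ballI) (auto intro: DERIV_isCont)
    qed (use deriv in simp)
  qed simp
  then show ?thesis using even[of t] by (cases "t \<ge> 0") auto
qed

text \<open>Passes from a hypothesis about sequences to a bound uniform over a shrinking interval,
  since the minimizer depends on the data and is no fixed sequence.\<close>

lemma cond_P2_local_lower_bound:
  assumes P2: "cond_P2_local \<eta> L" and L: "\<And>n. n \<ge> 1 \<Longrightarrow> L n > 0"
  shows "\<forall>\<^sub>F n in sequentially. \<forall>t. t \<noteq> 0 \<longrightarrow> \<bar>t\<bar> \<le> K / sqrt (real n) \<longrightarrow> L n / 2 * \<bar>t\<bar> < \<eta> (L n) t"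
proof -
  \<comment> \<open>Points violating the bound would form a sequence contradicting the hypothesis.\<close>
  define bad where "bad n t \<longleftrightarrow> t \<noteq> 0 \<and> \<bar>t\<bar> \<le> K / sqrt (real n) \<and> \<not> L n / 2 * \<bar>t\<bar> < \<eta> (L n) t" for n t
  \<comment> \<open>The default keeps the sequence nonzero and of the required order where nothing
    is bad; the shift by 1 makes it nonzero also at \<open>n = 0\<close>.\<close>
  define t where "t n = (if \<exists>t. bad n t then SOME t. bad n t else 1 / sqrt (real n + 1))" for n
  have t_bad: "bad n (t n)" if "bad n u" for n u
    unfolding t_def using that by (auto intro: someI)
  have t_cases: "bad n (t n) \<or> t n = 1 / sqrt (real n + 1)" for n
    unfolding t_def by (auto intro: someI)
  have nz: "t n \<noteq> 0" for n
  proof -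
    have "1 / sqrt (real n + 1) \<noteq> 0" by simp
    then show ?thesis using t_cases[of n] unfolding bad_def by metis
  qed
  have "t \<in> O(\<lambda>n. 1 / sqrt (real n))"
  proof (rule bigoI[where c = "max K 1"], rule eventually_mono[OF eventually_ge_at_top[of 1]])
    fix n :: nat assume n: "n \<ge> 1"
    have "\<bar>t n\<bar> \<le> max K 1 / sqrt (real n)"
      using t_cases[of n]
    proof
      assume "bad n (t n)"
      then have "\<bar>t n\<bar> \<le> K / sqrt (real n)" by (simp add: bad_def)
      also have "\<dots> \<le> max K 1 / sqrt (real n)" by (intro divide_right_mono) auto
      finally show ?thesis .
    next
      assume "t n = 1 / sqrt (real n + 1)"
      then have "\<bar>t n\<bar> = 1 / sqrt (real n + 1)" by simp
      also have "\<dots> \<le> 1 / sqrt (real n)" using n by (intro divide_left_mono) auto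
      also have "\<dots> \<le> max K 1 / sqrt (real n)" by (intro divide_right_mono) auto
      finally show ?thesis .
    qed
    then show "norm (t n) \<le> max K 1 * norm (1 / sqrt (real n))" by simp
  qed
  with P2 nz have "(\<lambda>n. \<eta> (L n) (t n) / \<bar>t n\<bar>) \<sim>[at_top] L"
    unfolding cond_P2_local_def by blast
  \<comment> \<open>Asymptotic equivalence sets the ratio to 1 where both sides vanish; positivity
    of \<open>L n\<close> rules this case out below.\<close>
  then have "\<forall>\<^sub>F n in sequentially. 1 / 2 < (if \<eta> (L n) (t n) / \<bar>t n\<bar> = 0 \<and> L n = 0 then 1
      else \<eta> (L n) (t n) / \<bar>t n\<bar> / L n)"
    unfolding asymp_equiv_def by (rule order_tendstoD) simp
  then show ?thesis
    using eventually_ge_at_top[of 1]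
  proof eventually_elim
    case (elim n)
    then have "1 / 2 < \<eta> (L n) (t n) / \<bar>t n\<bar> / L n" using L[of n] by simp
    then have "L n / 2 * \<bar>t n\<bar> < \<eta> (L n) (t n)"
      using L[of n] elim nz[of n] by (simp add: field_simps)
    then have "\<not> bad n u" for u using t_bad[of n u] by (auto simp: bad_def)
    then show ?case unfolding bad_def by blast
  qed
qed

section \<open>Fluctuations of the score\<close>

text \<open>The mixed terms of the expanded square factor by independence and vanish by
  centring.\<close>

lemma (in prob_space) second_moment_sum_indep:
  fixes W :: "'i \<Rightarrow> 'a \<Rightarrow> real"
  assumes "finite I" and indep: "indep_vars (\<lambda>_. borel) W I"
    and sq: "\<And>i. i \<in> I \<Longrightarrow> integrable M (\<lambda>\<omega>. (W i \<omega>)\<^sup>2)"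
    and mean: "\<And>i. i \<in> I \<Longrightarrow> expectation (W i) = 0"
  shows "integrable M (\<lambda>\<omega>. (\<Sum>i\<in>I. W i \<omega>)\<^sup>2)"
    and "expectation (\<lambda>\<omega>. (\<Sum>i\<in>I. W i \<omega>)\<^sup>2) = (\<Sum>i\<in>I. expectation (\<lambda>\<omega>. (W i \<omega>)\<^sup>2))"
proof -
  have W_meas: "W i \<in> borel_measurable M" if "i \<in> I" for i
    using indep that by (auto simp: indep_vars_def)
  have W_int: "integrable M (W i)" if "i \<in> I" for i
    by (rule square_integrable_imp_integrable[OF W_meas sq]) (use that in auto)
  have prod: "integrable M (\<lambda>\<omega>. W i \<omega> * W k \<omega>) \<and> expectation (\<lambda>\<omega>. W i \<omega> * W k \<omega>)
      = (if i = k then expectation (\<lambda>\<omega>. (W i \<omega>)\<^sup>2) else 0)" if "i \<in> I" "k \<in> I" for i k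
  proof (cases "i = k")
    case True then show ?thesis using sq[OF that(1)] by (simp add: power2_eq_square)
  next
    case False
    have ind: "indep_vars (\<lambda>_. borel) W {i, k}"
      by (rule indep_vars_subset[OF indep]) (use that in auto)
    show ?thesis
      using indep_vars_lebesgue_integral[OF _ ind] indep_vars_integrable[OF _ ind]
        W_int[OF that(1)] W_int[OF that(2)] mean[OF that(1)] False by auto
  qed
  have expand: "(\<Sum>i\<in>I. W i \<omega>)\<^sup>2 = (\<Sum>i\<in>I. \<Sum>k\<in>I. W i \<omega> * W k \<omega>)" for \<omega>
    by (simp add: power2_eq_square sum_product)
  show "integrable M (\<lambda>\<omega>. (\<Sum>i\<in>I. W i \<omega>)\<^sup>2)"
    unfolding expand by (intro Bochner_Integration.integrable_sum) (use prod in blast)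
  have "expectation (\<lambda>\<omega>. (\<Sum>i\<in>I. W i \<omega>)\<^sup>2) = (\<Sum>i\<in>I. \<Sum>k\<in>I. expectation (\<lambda>\<omega>. W i \<omega> * W k \<omega>))"
    unfolding expand using prod
    by (simp add: Bochner_Integration.integral_sum Bochner_Integration.integrable_sum)
  also have "\<dots> = (\<Sum>i\<in>I. \<Sum>k\<in>I. if i = k then expectation (\<lambda>\<omega>. (W i \<omega>)\<^sup>2) else 0)"
    using prod by (intro sum.cong refl) blast
  also have "\<dots> = (\<Sum>i\<in>I. expectation (\<lambda>\<omega>. (W i \<omega>)\<^sup>2))"
    using \<open>finite I\<close> by (simp add: sum.delta')
  finally show "expectation (\<lambda>\<omega>. (\<Sum>i\<in>I. W i \<omega>)\<^sup>2) = (\<Sum>i\<in>I. expectation (\<lambda>\<omega>. (W i \<omega>)\<^sup>2))" .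
qed

text \<open>Chebyshev's inequality, with the variance computed coordinate by coordinate. The
  threshold grows like the square root of \<open>n\<close>, so the bound is free of
  \<open>n\<close>.\<close>

lemma (in prob_space) prob_norm_sum_indep_le:
  fixes W :: "nat \<Rightarrow> 'a \<Rightarrow> real ^ 'n"
  assumes indep: "indep_vars (\<lambda>_. borel) W {1..n}"
    and sq: "\<And>i. i \<in> {1..n} \<Longrightarrow> integrable M (\<lambda>\<omega>. (norm (W i \<omega>))\<^sup>2)"
    and mean: "\<And>i j. i \<in> {1..n} \<Longrightarrow> expectation (\<lambda>\<omega>. W i \<omega> $ j) = 0"
    and bound: "\<And>i. i \<in> {1..n} \<Longrightarrow> expectation (\<lambda>\<omega>. (norm (W i \<omega>))\<^sup>2) \<le> V"
    and n: "n \<ge> 1" and K: "K > 0"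
  shows "prob {\<omega> \<in> space M. norm (\<Sum>i = 1..n. W i \<omega>) \<ge> K * sqrt (real n)} \<le> V / K\<^sup>2"
proof -
  have W_meas: "W i \<in> borel_measurable M" if "i \<in> {1..n}" for i
    using indep that by (auto simp: indep_vars_def)
  have comp_meas: "(\<lambda>\<omega>. W i \<omega> $ j) \<in> borel_measurable M" if "i \<in> {1..n}" for i j
    by (rule measurable_compose[OF W_meas[OF that]])
       (intro borel_measurable_continuous_onI continuous_intros)
  have indep_comp: "indep_vars (\<lambda>_. borel) (\<lambda>i \<omega>. W i \<omega> $ j) {1..n}" for j
    by (rule indep_vars_compose2[OF indep]) auto
  have comp_sq: "integrable M (\<lambda>\<omega>. (W i \<omega> $ j)\<^sup>2)" if i: "i \<in> {1..n}" for i j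
  proof (rule Bochner_Integration.integrable_bound[OF sq[OF i]])
    show "(\<lambda>\<omega>. (W i \<omega> $ j)\<^sup>2) \<in> borel_measurable M" using comp_meas[OF i] by measurable
    show "AE \<omega> in M. norm ((W i \<omega> $ j)\<^sup>2) \<le> norm ((norm (W i \<omega>))\<^sup>2)"
      using component_le_norm_cart by (auto simp: abs_le_square_iff[symmetric])
  qed
  let ?S = "\<lambda>\<omega>. \<Sum>i = 1..n. W i \<omega>"
  have S_sq: "(norm (?S \<omega>))\<^sup>2 = (\<Sum>j\<in>UNIV. (\<Sum>i = 1..n. W i \<omega> $ j)\<^sup>2)" for \<omega>
    by (simp add: norm_power2_vec)
  note comp_sum = second_moment_sum_indep[OF _ indep_comp comp_sq mean, simplified]
  have "expectation (\<lambda>\<omega>. (norm (?S \<omega>))\<^sup>2) = (\<Sum>j\<in>UNIV. \<Sum>i = 1..n. expectation (\<lambda>\<omega>. (W i \<omega> $ j)\<^sup>2))"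
    unfolding S_sq using comp_sum by (simp add: Bochner_Integration.integral_sum)
  also have "\<dots> = (\<Sum>i = 1..n. \<Sum>j\<in>UNIV. expectation (\<lambda>\<omega>. (W i \<omega> $ j)\<^sup>2))" by (rule sum.swap)
  also have "\<dots> = (\<Sum>i = 1..n. expectation (\<lambda>\<omega>. (norm (W i \<omega>))\<^sup>2))"
    using comp_sq by (intro sum.cong refl) (simp add: norm_power2_vec Bochner_Integration.integral_sum)
  also have "\<dots> \<le> (\<Sum>i = 1..n. V)" by (intro sum_mono bound)
  also have "\<dots> = n * V" by simp
  finally have second: "expectation (\<lambda>\<omega>. (norm (?S \<omega>))\<^sup>2) \<le> n * V" .
  have "prob {\<omega> \<in> space M. \<bar>norm (?S \<omega>)\<bar> \<ge> K * sqrt (real n)}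
      \<le> expectation (\<lambda>\<omega>. (norm (?S \<omega>))\<^sup>2) / (K * sqrt (real n))\<^sup>2"
  proof (rule second_moment_method)
    have [measurable]: "?S \<in> borel_measurable M" by (rule borel_measurable_sum) (rule W_meas)
    show "(\<lambda>\<omega>. norm (?S \<omega>)) \<in> borel_measurable M" by measurable
    show "integrable M (\<lambda>\<omega>. (norm (?S \<omega>))\<^sup>2)"
      unfolding S_sq using comp_sum by (intro Bochner_Integration.integrable_sum) auto
  qed (use n K in auto)
  also have "\<dots> \<le> (n * V) / (K * sqrt (real n))\<^sup>2" by (intro divide_right_mono second) simp
  also have "\<dots> = V / K\<^sup>2" using n by (simp add: power_mult_distrib)
  finally show ?thesis by simp
qed

text \<open>Pairing \<open>u v* A\<close> with itself moves the matrix to the other factor, where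
  the bound for \<open>A *v _\<close> applies; one norm then cancels.\<close>

lemma norm_vector_matrix_mult_le:
  fixes A :: "real ^ 'n ^ 'm"
  shows "norm (u v* A) \<le> norm A * norm u"
proof -
  have "(norm (u v* A))\<^sup>2 = u \<bullet> (A *v (u v* A))"
    by (simp add: power2_norm_eq_inner dot_lmul_matrix)
  also have "\<dots> \<le> norm u * norm (A *v (u v* A))" by (rule norm_cauchy_schwarz)
  also have "\<dots> \<le> norm u * (norm A * norm (u v* A))"
    by (intro mult_left_mono norm_matrix_vector_mult_le) simp
  finally have "norm (u v* A) * norm (u v* A) \<le> (norm A * norm u) * norm (u v* A)"
    by (simp add: power2_eq_square mult_ac)
  then show ?thesis by (cases "norm (u v* A) = 0") (simp_all add: mult_le_cancel_right)
qed

lemma (in prob_space) expectation_natural: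
  fixes \<nu> :: "(real ^ 'r) measure"
  assumes \<nu>: "sets \<nu> = sets borel" and b: "b \<in> borel_measurable borel"
    and \<theta>: "\<theta> \<in> interior (natural_parameter_space \<nu> b)"
    and dist: "distributed M \<nu> Y (\<lambda>y. ennreal (nef_density \<nu> b \<theta> y))"
    and g: "subexponential g"
  shows "integrable M (\<lambda>\<omega>. g (Y \<omega>))"
    and "expectation (\<lambda>\<omega>. g (Y \<omega>)) = exp_moment \<nu> b g \<theta> / exp_moment \<nu> b (\<lambda>_. 1) \<theta>"
proof -
  have gm: "g \<in> borel_measurable \<nu>"
    using g by (simp add: subexponential_def borel_measurable_nu_iff[OF \<nu> b])
  have nn: "\<And>y. y \<in> space \<nu> \<Longrightarrow> 0 \<le> nef_density \<nu> b \<theta> y" by (simp add: nef_density_def)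
  show "integrable M (\<lambda>\<omega>. g (Y \<omega>))"
    using distributed_integrable[OF dist gm nn] integral_nef_density(2)[OF \<nu> b \<theta> g] by simp
  show "expectation (\<lambda>\<omega>. g (Y \<omega>)) = exp_moment \<nu> b g \<theta> / exp_moment \<nu> b (\<lambda>_. 1) \<theta>"
    using distributed_integral[OF dist gm nn] integral_nef_density(1)[OF \<nu> b \<theta>] by simp
qed

section \<open>The score of the model at the true parameter\<close>

context glm_regressors
begin

text \<open>Minus the score, that is, the gradient of the negative log-likelihood at
  \<open>\<beta>\<close>; with this sign it is the linear term in the expansion of the function to
  be minimized.\<close>

definition score_deviation ::
    "(nat \<Rightarrow> real ^ 'p ^ 'r) \<Rightarrow> real ^ 'p \<Rightarrow> nat \<Rightarrow> (nat \<Rightarrow> real ^ 'r) \<Rightarrow> real ^ 'p" where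
  "score_deviation X \<beta> n y = (\<Sum>i = 1..n. mean_score (X i) \<beta> - y i v* X i)"

text \<open>The summands are centred because the gradient of the log-partition function is the mean.
  Their second moments are bounded uniformly in \<open>i\<close>, since those of the responses are
  continuous functions of the regressor on the compact set \<open>\<X>\<close>.\<close>

lemma score_deviation_tail:
  assumes M: "prob_space M" and \<beta>\<^sub>0: "\<beta>\<^sub>0 \<in> B" and X: "\<forall>i\<ge>1. X i \<in> \<X>"
    and indep: "prob_space.indep_vars M (\<lambda>_. borel) Y {1..}"
    and dist: "\<forall>i\<ge>1. distributed M \<nu> (Y i) (\<lambda>y. ennreal (nef_density \<nu> b (X i *v \<beta>\<^sub>0) y))"
  obtains V where "V \<ge> 0" "\<And>n K. n \<ge> 1 \<Longrightarrow> K > 0 \<Longrightarrow>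
    measure M {\<omega> \<in> space M. norm (score_deviation X \<beta>\<^sub>0 n (\<lambda>i. Y i \<omega>)) \<ge> K * sqrt (real n)} \<le> V / K\<^sup>2"
proof -
  interpret prob_space M by (rule M)
  let ?Z = "exp_moment \<nu> b (\<lambda>_. 1)"
  let ?Z\<^sub>2 = "\<lambda>k. exp_moment \<nu> b (\<lambda>y. 1 * y $ k * y $ k)"
  have "continuous_on \<X> (\<lambda>x. \<Sum>k\<in>UNIV. ?Z\<^sub>2 k (x *v \<beta>\<^sub>0) / ?Z (x *v \<beta>\<^sub>0))"
  proof (intro continuous_intros)
    have lin: "continuous_on \<X> (\<lambda>x. x *v \<beta>\<^sub>0)"
      unfolding matrix_vector_mult_def by (intro continuous_intros)
    have "continuous_on \<X> (\<lambda>x. exp_moment \<nu> b g (x *v \<beta>\<^sub>0))" if "subexponential g" for g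
    proof (rule continuous_on_compose2[OF _ lin])
      show "continuous_on (interior (natural_parameter_space \<nu> b)) (exp_moment \<nu> b g)"
        by (intro continuous_at_imp_continuous_on ballI isCont_exp_moment[OF sets_nu b_meas that])
    qed (use predictor_interior \<beta>\<^sub>0 in auto)
    then show "continuous_on \<X> (\<lambda>x. ?Z\<^sub>2 k (x *v \<beta>\<^sub>0))" "continuous_on \<X> (\<lambda>x. ?Z (x *v \<beta>\<^sub>0))" for k
      by (blast intro: subexponential_mult_component subexponential_1)+
    show "\<forall>x\<in>\<X>. ?Z (x *v \<beta>\<^sub>0) \<noteq> 0"
      using exp_moment_1_pos[OF sets_nu b_meas] predictor_interior[OF _ \<beta>\<^sub>0] interior_subset
      by (metis less_irrefl subsetD)
  qed
  then have "bounded ((\<lambda>x. \<Sum>k\<in>UNIV. ?Z\<^sub>2 k (x *v \<beta>\<^sub>0) / ?Z (x *v \<beta>\<^sub>0)) ` \<X>)"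
    by (intro compact_imp_bounded compact_continuous_image compact_X)
  then obtain V\<^sub>0 where V\<^sub>0_abs: "\<And>x. x \<in> \<X> \<Longrightarrow> \<bar>\<Sum>k\<in>UNIV. ?Z\<^sub>2 k (x *v \<beta>\<^sub>0) / ?Z (x *v \<beta>\<^sub>0)\<bar> \<le> V\<^sub>0"
    unfolding bounded_iff ball_simps real_norm_def by blast
  have V\<^sub>0: "(\<Sum>k\<in>UNIV. ?Z\<^sub>2 k (x *v \<beta>\<^sub>0) / ?Z (x *v \<beta>\<^sub>0)) \<le> V\<^sub>0" if "x \<in> \<X>" for x
    by (rule order_trans[OF abs_ge_self V\<^sub>0_abs[OF that]])
  obtain R where R: "\<And>x. x \<in> \<X> \<Longrightarrow> norm x \<le> R"
    using compact_imp_bounded[OF compact_X] by (auto simp: bounded_iff)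
  define D where "D i = gradient (log_partition \<nu> b) (X i *v \<beta>\<^sub>0)" for i
  define W where "W i y = (D i - y) v* X i" for i y
  have score: "score_deviation X \<beta>\<^sub>0 n (\<lambda>i. Y i \<omega>) = (\<Sum>i = 1..n. W i (Y i \<omega>))" for n \<omega>
    by (simp add: score_deviation_def mean_score_def W_def D_def vec_eq_iff vector_matrix_mult_def
        sum_subtractf left_diff_distrib)
  have W_meas: "W i \<in> borel_measurable borel" for i
    unfolding W_def vector_matrix_mult_def
    by (intro borel_measurable_continuous_onI continuous_intros)
  have each: "integrable M (\<lambda>\<omega>. (norm (W i (Y i \<omega>)))\<^sup>2) \<and> expectation (\<lambda>\<omega>. (norm (W i (Y i \<omega>)))\<^sup>2) \<le> R\<^sup>2 * V\<^sub>0
      \<and> (\<forall>j. expectation (\<lambda>\<omega>. W i (Y i \<omega>) $ j) = 0)" if i: "i \<ge> 1" for i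
  proof -
    have Xi: "X i \<in> \<X>" and \<theta>: "X i *v \<beta>\<^sub>0 \<in> interior (natural_parameter_space \<nu> b)"
      using X i predictor_interior \<beta>\<^sub>0 by auto
    note expect = expectation_natural[OF sets_nu b_meas \<theta> dist[rule_format, OF i]]
    note sub1 = subexponential_mult_component[OF subexponential_1]
    note sub2 = subexponential_mult_component[OF sub1]
    have Yi: "Y i \<in> borel_measurable M" using indep i by (auto simp: indep_vars_def)
    have D_eq: "D i $ k = expectation (\<lambda>\<omega>. Y i \<omega> $ k)" for k
      unfolding D_def gradient_log_partition[OF sets_nu b_meas \<theta>]
      using expect(2)[OF sub1[of k]] by simp
    have int1: "integrable M (\<lambda>\<omega>. Y i \<omega> $ k)" for k using expect(1)[OF sub1[of k]] by simp
    have int2: "integrable M (\<lambda>\<omega>. (Y i \<omega> $ k)\<^sup>2)" for k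
      using expect(1)[OF sub2[of k k]] by (simp add: power2_eq_square)
    have exp2: "expectation (\<lambda>\<omega>. (Y i \<omega> $ k)\<^sup>2) = ?Z\<^sub>2 k (X i *v \<beta>\<^sub>0) / ?Z (X i *v \<beta>\<^sub>0)" for k
      using expect(2)[OF sub2[of k k]] by (simp add: power2_eq_square)
    have sq_eq: "(D i $ k - Y i \<omega> $ k)\<^sup>2 = (D i $ k)\<^sup>2 - 2 * D i $ k * Y i \<omega> $ k + (Y i \<omega> $ k)\<^sup>2" for k \<omega>
      by (simp add: power2_eq_square algebra_simps)
    have int_dev: "integrable M (\<lambda>\<omega>. (D i $ k - Y i \<omega> $ k)\<^sup>2)" for k
      unfolding sq_eq using int1 int2 by simp
    have "expectation (\<lambda>\<omega>. (D i $ k - Y i \<omega> $ k)\<^sup>2) = expectation (\<lambda>\<omega>. (Y i \<omega> $ k)\<^sup>2) - (D i $ k)\<^sup>2" for k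
      unfolding sq_eq using int1 int2 by (simp add: prob_space D_eq[symmetric] power2_eq_square)
    \<comment> \<open>The variance is at most the raw second moment, so bounding the latter over
      \<open>\<X>\<close> by \<open>V\<^sub>0\<close> suffices.\<close>
    then have exp_dev: "expectation (\<lambda>\<omega>. (D i $ k - Y i \<omega> $ k)\<^sup>2) \<le> ?Z\<^sub>2 k (X i *v \<beta>\<^sub>0) / ?Z (X i *v \<beta>\<^sub>0)" for k
      using exp2[of k] by simp
    have norm_sq: "(norm (D i - Y i \<omega>))\<^sup>2 = (\<Sum>k\<in>UNIV. (D i $ k - Y i \<omega> $ k)\<^sup>2)" for \<omega>
      by (simp add: norm_power2_vec)
    have U_int: "integrable M (\<lambda>\<omega>. R\<^sup>2 * (norm (D i - Y i \<omega>))\<^sup>2)"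
      unfolding norm_sq using int_dev by simp
    have le: "(norm (W i (Y i \<omega>)))\<^sup>2 \<le> R\<^sup>2 * (norm (D i - Y i \<omega>))\<^sup>2" for \<omega>
    proof -
      have "norm (W i (Y i \<omega>)) \<le> norm (X i) * norm (D i - Y i \<omega>)"
        unfolding W_def by (rule norm_vector_matrix_mult_le)
      also have "\<dots> \<le> R * norm (D i - Y i \<omega>)" by (intro mult_right_mono R Xi) simp
      finally show ?thesis
        using power_mono[of "norm (W i (Y i \<omega>))" "R * norm (D i - Y i \<omega>)" 2]
        by (simp add: power_mult_distrib)
    qed
    have W_int: "integrable M (\<lambda>\<omega>. (norm (W i (Y i \<omega>)))\<^sup>2)"
    proof (rule Bochner_Integration.integrable_bound[OF U_int])
      show "(\<lambda>\<omega>. (norm (W i (Y i \<omega>)))\<^sup>2) \<in> borel_measurable M"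
        using measurable_compose[OF Yi W_meas[of i]] by measurable
    qed (use le in auto)
    have "expectation (\<lambda>\<omega>. (norm (W i (Y i \<omega>)))\<^sup>2) \<le> expectation (\<lambda>\<omega>. R\<^sup>2 * (norm (D i - Y i \<omega>))\<^sup>2)"
      by (rule integral_mono[OF W_int U_int le])
    also have "\<dots> = R\<^sup>2 * (\<Sum>k\<in>UNIV. expectation (\<lambda>\<omega>. (D i $ k - Y i \<omega> $ k)\<^sup>2))"
      unfolding norm_sq using int_dev by (simp add: Bochner_Integration.integral_sum)
    also have "\<dots> \<le> R\<^sup>2 * (\<Sum>k\<in>UNIV. ?Z\<^sub>2 k (X i *v \<beta>\<^sub>0) / ?Z (X i *v \<beta>\<^sub>0))"
      by (intro mult_left_mono sum_mono exp_dev) simp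
    also have "\<dots> \<le> R\<^sup>2 * V\<^sub>0" by (intro mult_left_mono V\<^sub>0 Xi) simp
    finally have W_exp: "expectation (\<lambda>\<omega>. (norm (W i (Y i \<omega>)))\<^sup>2) \<le> R\<^sup>2 * V\<^sub>0" .
    have W_comp: "W i (Y i \<omega>) $ j = (\<Sum>k\<in>UNIV. X i $ k $ j * (D i $ k - Y i \<omega> $ k))" for j \<omega>
      by (simp add: W_def vector_matrix_mult_def mult.commute)
    have "expectation (\<lambda>\<omega>. W i (Y i \<omega>) $ j) = 0" for j
      unfolding W_comp using int1
      by (simp add: Bochner_Integration.integral_sum prob_space D_eq[symmetric])
    with W_int W_exp show ?thesis by blast
  qed
  have "measure M {\<omega> \<in> space M. norm (score_deviation X \<beta>\<^sub>0 n (\<lambda>i. Y i \<omega>)) \<ge> K * sqrt (real n)}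
      \<le> (R\<^sup>2 * V\<^sub>0) / K\<^sup>2" if "n \<ge> 1" "K > 0" for n K
    unfolding score
  proof (rule prob_norm_sum_indep_le)
    have "indep_vars (\<lambda>_. borel) Y {1..n}" by (rule indep_vars_subset[OF indep]) auto
    then show "indep_vars (\<lambda>_. borel) (\<lambda>i \<omega>. W i (Y i \<omega>)) {1..n}"
      by (rule indep_vars_compose2) (rule W_meas)
  qed (use each that in auto)
  moreover have "0 \<le> expectation (\<lambda>\<omega>. (norm (W 1 (Y 1 \<omega>)))\<^sup>2)" by simp
  then have "R\<^sup>2 * V\<^sub>0 \<ge> 0" using each[of 1] by linarith
  ultimately show thesis using that[of "R\<^sup>2 * V\<^sub>0"] by blast
qed

lemma borel_measurable_score_deviation:
  assumes "\<And>i. i \<ge> 1 \<Longrightarrow> Y i \<in> borel_measurable M"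
  shows "(\<lambda>\<omega>. score_deviation X \<beta> n (\<lambda>i. Y i \<omega>)) \<in> borel_measurable M"
  unfolding score_deviation_def
proof (rule borel_measurable_sum)
  fix i assume "i \<in> {1..n}"
  then have "Y i \<in> borel_measurable M" using assms by simp
  moreover have "(\<lambda>y. mean_score (X i) \<beta> - y v* X i) \<in> borel_measurable borel"
    unfolding vector_matrix_mult_def
    by (intro borel_measurable_continuous_onI continuous_intros)
  ultimately show "(\<lambda>\<omega>. mean_score (X i) \<beta> - Y i \<omega> v* X i) \<in> borel_measurable M"
    by (rule measurable_compose)
qed

end

section \<open>Quadratic growth of the negative log-likelihood\<close>

text \<open>The constant is the minimum of the form over the unit sphere; homogeneity extends the
  bound to all vectors.\<close>

lemma positive_definite_lower_bound:
  fixes A :: "real ^ 'n ^ 'n"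
  assumes "positive_definite A"
  obtains \<kappa> where "\<kappa> > 0" "\<And>v. \<kappa> * (norm v)\<^sup>2 \<le> v \<bullet> (A *v v)"
proof -
  have cont: "continuous_on (sphere 0 1) (\<lambda>v. v \<bullet> (A *v v))"
    unfolding matrix_vector_mult_def by (intro continuous_intros)
  have "axis undefined 1 \<in> sphere (0 :: real ^ 'n) 1" by simp
  then have "sphere (0 :: real ^ 'n) 1 \<noteq> {}" by blast
  from continuous_attains_inf[OF compact_sphere this cont]
  obtain w where w: "w \<in> sphere 0 1" "\<And>v. v \<in> sphere 0 1 \<Longrightarrow> w \<bullet> (A *v w) \<le> v \<bullet> (A *v v)"
    by blast
  have "w \<bullet> (A *v w) * (norm v)\<^sup>2 \<le> v \<bullet> (A *v v)" for v
  proof (cases "v = 0")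
    case False
    define u where "u = (1 / norm v) *\<^sub>R v"
    have "w \<bullet> (A *v w) * (norm v)\<^sup>2 \<le> u \<bullet> (A *v u) * (norm v)\<^sup>2"
      using False by (intro mult_right_mono w(2)) (simp_all add: u_def)
    also have "\<dots> = v \<bullet> (A *v v)"
      using False by (simp add: u_def linear_cmul[OF matrix_vector_mul_linear] power2_eq_square)
    finally show ?thesis .
  qed simp
  moreover have "w \<bullet> (A *v w) > 0"
  proof -
    have "w \<noteq> 0" using w(1) by auto
    then show ?thesis using assms by (simp add: positive_definite_def)
  qed
  ultimately show thesis using that by blast
qed

lemma quadratic_form_sum:
  fixes A :: "'i \<Rightarrow> real ^ 'n ^ 'n"
  shows "v \<bullet> (sum A I *v v) = (\<Sum>i\<in>I. v \<bullet> (A i *v v))"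
proof (induction I rule: infinite_finite_induct)
  case (insert i I)
  then show ?case by (simp add: matrix_vector_mult_add_rdistrib inner_add_right)
qed simp_all

context glm_regressors
begin

abbreviation (input) neg_loglik ::
    "(nat \<Rightarrow> real ^ 'p ^ 'r) \<Rightarrow> nat \<Rightarrow> (nat \<Rightarrow> real ^ 'r) \<Rightarrow> real ^ 'p \<Rightarrow> real" where
  "neg_loglik X n y \<beta> \<equiv> - (\<Sum>i = 1..n. loglik \<nu> b (y i) (X i) \<beta>)"

lemma neg_loglik_eq:
  "neg_loglik X n y \<beta> = (\<Sum>i = 1..n. log_partition \<nu> b (X i *v \<beta>) - (y i v* X i) \<bullet> \<beta> - b (y i))"
  by (simp add: loglik_def dot_lmul_matrix sum_negf[symmetric] algebra_simps)

lemma convex_on_neg_loglik: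
  assumes "\<forall>i\<ge>1. X i \<in> \<X>"
  shows "convex_on B (neg_loglik X n y)"
proof -
  have each: "convex_on B (\<lambda>\<beta>. log_partition \<nu> b (X i *v \<beta>) + (- (y i v* X i) \<bullet> \<beta> - b (y i)))"
    if "i \<in> {1..n}" for i
  proof (rule convex_on_add)
    show "convex_on B (\<lambda>\<beta>. log_partition \<nu> b (X i *v \<beta>))"
      using assms that by (intro convex_on_log_partition_predictor) auto
    show "convex_on B (\<lambda>\<beta>. - (y i v* X i) \<bullet> \<beta> - b (y i))"
      by (rule convex_onI) (auto simp: convex_B inner_add_right inner_diff_right algebra_simps)
  qed
  show ?thesis
    unfolding neg_loglik_eq
  proof (rule convex_onI)
    fix t :: real and u v assume t: "0 < t" "t < 1" and uv: "u \<in> B" "v \<in> B"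
    show "(\<Sum>i = 1..n. log_partition \<nu> b (X i *v ((1 - t) *\<^sub>R u + t *\<^sub>R v)) - (y i v* X i) \<bullet> ((1 - t) *\<^sub>R u + t *\<^sub>R v) - b (y i))
      \<le> (1 - t) * (\<Sum>i = 1..n. log_partition \<nu> b (X i *v u) - (y i v* X i) \<bullet> u - b (y i))
        + t * (\<Sum>i = 1..n. log_partition \<nu> b (X i *v v) - (y i v* X i) \<bullet> v - b (y i))"
      unfolding sum_distrib_left sum.distrib[symmetric]
      using convex_onD[OF each, of _ t u v] t uv by (intro sum_mono) (simp add: algebra_simps)
  qed (rule convex_B)
qed

text \<open>Up to a constant in the coefficients, \<open>y\<close> occurs only in a linear term,
  which is absorbed into \<open>score_deviation\<close>. Therefore the constants and the threshold
  for \<open>n\<close> can be chosen before \<open>y\<close>.\<close>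

lemma neg_loglik_bounds:
  assumes \<beta>\<^sub>0: "\<beta>\<^sub>0 \<in> B" and X: "\<forall>i\<ge>1. X i \<in> \<X>" and C2: "cond_C2 \<nu> b \<X> B X"
  obtains r c C where "r > 0" "c > 0" "C \<ge> 0" "cball \<beta>\<^sub>0 r \<subseteq> B"
    "\<forall>\<^sub>F n in sequentially. \<forall>y. \<forall>\<beta> \<in> cball \<beta>\<^sub>0 r. neg_loglik X n y \<beta> \<ge>
       neg_loglik X n y \<beta>\<^sub>0 + score_deviation X \<beta>\<^sub>0 n y \<bullet> (\<beta> - \<beta>\<^sub>0) + real n * c * (norm (\<beta> - \<beta>\<^sub>0))\<^sup>2"
    "\<forall>n y. \<forall>\<rho>\<le>r. \<forall>u \<in> cball \<beta>\<^sub>0 \<rho>. \<forall>v \<in> cball \<beta>\<^sub>0 \<rho>.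
       neg_loglik X n y u - neg_loglik X n y v
         \<le> (norm (score_deviation X \<beta>\<^sub>0 n y) + real n * C * \<rho>) * norm (u - v)"
proof -
  obtain J where J: "positive_definite J"
    "(\<lambda>n. (1 / real n) *\<^sub>R (\<Sum>i = 1..n. glm_info \<nu> b \<beta>\<^sub>0 (X i))) \<longlonglongrightarrow> J"
    using C2 \<beta>\<^sub>0 unfolding cond_C2_def Let_def by blast
  obtain \<kappa> where \<kappa>: "\<kappa> > 0" "\<And>v. \<kappa> * (norm v)\<^sup>2 \<le> v \<bullet> (J *v v)"
    using positive_definite_lower_bound[OF J(1)] by blast
  obtain r where r: "r > 0" "cball \<beta>\<^sub>0 r \<subseteq> B" and
    lower: "\<And>X \<beta>. X \<in> \<X> \<Longrightarrow> \<beta> \<in> cball \<beta>\<^sub>0 r \<Longrightarrow>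
       log_partition \<nu> b (X *v \<beta>) \<ge> log_partition \<nu> b (X *v \<beta>\<^sub>0) + mean_score X \<beta>\<^sub>0 \<bullet> (\<beta> - \<beta>\<^sub>0)
         + (\<beta> - \<beta>\<^sub>0) \<bullet> (glm_info \<nu> b \<beta>\<^sub>0 X *v (\<beta> - \<beta>\<^sub>0)) / 2 - \<kappa> / 8 * (norm (\<beta> - \<beta>\<^sub>0))\<^sup>2"
    \<comment> \<open>For large \<open>n\<close> the averaged form exceeds
      \<open>\<kappa> / 2\<close> times the squared norm, Taylor's formula halves this to
      \<open>\<kappa> / 4\<close>, and giving up \<open>\<kappa> / 8\<close> leaves
      \<open>c = \<kappa> / 8\<close>.\<close>
    using uniform_quadratic_lower_bound[OF \<beta>\<^sub>0, of "\<kappa> / 8"] \<kappa>(1) by auto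
  obtain C where C: "C \<ge> 0" and
    linear: "\<And>X \<rho> u v. X \<in> \<X> \<Longrightarrow> \<rho> \<le> r \<Longrightarrow> u \<in> cball \<beta>\<^sub>0 \<rho> \<Longrightarrow> v \<in> cball \<beta>\<^sub>0 \<rho> \<Longrightarrow>
       \<bar>log_partition \<nu> b (X *v u) - log_partition \<nu> b (X *v v) - mean_score X \<beta>\<^sub>0 \<bullet> (u - v)\<bar>
         \<le> C * \<rho> * norm (u - v)"
    using uniform_linearization_bound[OF r(2) \<beta>\<^sub>0] by blast
  have score: "score_deviation X \<beta>\<^sub>0 n y \<bullet> v
      = (\<Sum>i = 1..n. mean_score (X i) \<beta>\<^sub>0 \<bullet> v - (y i v* X i) \<bullet> v)" for n y v
    by (simp add: score_deviation_def inner_sum_left inner_diff_left)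
  have "\<forall>\<^sub>F n in sequentially. dist ((1 / real n) *\<^sub>R (\<Sum>i = 1..n. glm_info \<nu> b \<beta>\<^sub>0 (X i))) J < \<kappa> / 2"
    using tendstoD[OF J(2), of "\<kappa> / 2"] \<kappa>(1) by simp
  then have quad: "\<forall>\<^sub>F n in sequentially. \<forall>y. \<forall>\<beta> \<in> cball \<beta>\<^sub>0 r. neg_loglik X n y \<beta> \<ge>
       neg_loglik X n y \<beta>\<^sub>0 + score_deviation X \<beta>\<^sub>0 n y \<bullet> (\<beta> - \<beta>\<^sub>0) + real n * (\<kappa> / 8) * (norm (\<beta> - \<beta>\<^sub>0))\<^sup>2"
    using eventually_ge_at_top[of 1]
  proof eventually_elim
    case (elim n)
    show ?case
    proof (intro allI ballI)
      fix y \<beta> assume \<beta>: "\<beta> \<in> cball \<beta>\<^sub>0 r"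
      define v where "v = \<beta> - \<beta>\<^sub>0"
      define A where "A = (1 / real n) *\<^sub>R (\<Sum>i = 1..n. glm_info \<nu> b \<beta>\<^sub>0 (X i))"
      have "\<bar>v \<bullet> ((A - J) *v v)\<bar> \<le> norm (A - J) * (norm v)\<^sup>2" by (rule abs_quadratic_form_le)
      also have "\<dots> \<le> \<kappa> / 2 * (norm v)\<^sup>2"
        using elim(1) by (intro mult_right_mono) (auto simp: A_def dist_norm)
      finally have "\<bar>v \<bullet> ((A - J) *v v)\<bar> \<le> \<kappa> / 2 * (norm v)\<^sup>2" .
      moreover have "v \<bullet> (A *v v) = v \<bullet> (J *v v) + v \<bullet> ((A - J) *v v)"
        by (simp add: matrix_vector_mult_diff_rdistrib inner_diff_right)
      ultimately have "v \<bullet> (A *v v) \<ge> \<kappa> / 2 * (norm v)\<^sup>2"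
        using \<kappa>(2)[of v] by linarith
      then have "real n * (\<kappa> / 2 * (norm v)\<^sup>2) \<le> real n * (v \<bullet> (A *v v))"
        by (rule mult_left_mono) simp
      also have "real n * (v \<bullet> (A *v v)) = (\<Sum>i = 1..n. v \<bullet> (glm_info \<nu> b \<beta>\<^sub>0 (X i) *v v))"
        using elim(2) by (simp add: A_def quadratic_form_sum flip: scaleR_matrix_vector_assoc)
      finally have info: "real n * (\<kappa> / 2 * (norm v)\<^sup>2) \<le> (\<Sum>i = 1..n. v \<bullet> (glm_info \<nu> b \<beta>\<^sub>0 (X i) *v v))" .
      have "(\<Sum>i = 1..n. log_partition \<nu> b (X i *v \<beta>)) \<ge> (\<Sum>i = 1..n. log_partition \<nu> b (X i *v \<beta>\<^sub>0)
          + mean_score (X i) \<beta>\<^sub>0 \<bullet> v + v \<bullet> (glm_info \<nu> b \<beta>\<^sub>0 (X i) *v v) / 2 - \<kappa> / 8 * (norm v)\<^sup>2)"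
        unfolding v_def using X by (intro sum_mono lower \<beta>) auto
      then have "(\<Sum>i = 1..n. log_partition \<nu> b (X i *v \<beta>)) \<ge> (\<Sum>i = 1..n. log_partition \<nu> b (X i *v \<beta>\<^sub>0))
          + (\<Sum>i = 1..n. mean_score (X i) \<beta>\<^sub>0 \<bullet> v)
          + (\<Sum>i = 1..n. v \<bullet> (glm_info \<nu> b \<beta>\<^sub>0 (X i) *v v)) / 2 - real n * (\<kappa> / 8 * (norm v)\<^sup>2)"
        by (simp add: sum.distrib sum_subtractf sum_divide_distrib)
      moreover have "(\<Sum>i = 1..n. (y i v* X i) \<bullet> \<beta>) - (\<Sum>i = 1..n. (y i v* X i) \<bullet> \<beta>\<^sub>0)
          = (\<Sum>i = 1..n. (y i v* X i) \<bullet> v)"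
        by (simp add: v_def inner_diff_right sum_subtractf)
      ultimately show "neg_loglik X n y \<beta> \<ge> neg_loglik X n y \<beta>\<^sub>0
          + score_deviation X \<beta>\<^sub>0 n y \<bullet> (\<beta> - \<beta>\<^sub>0) + real n * (\<kappa> / 8) * (norm (\<beta> - \<beta>\<^sub>0))\<^sup>2"
        unfolding neg_loglik_eq score v_def[symmetric] sum_subtractf using info by linarith
    qed
  qed
  have lin: "neg_loglik X n y u - neg_loglik X n y v
         \<le> (norm (score_deviation X \<beta>\<^sub>0 n y) + real n * C * \<rho>) * norm (u - v)"
    if \<rho>: "\<rho> \<le> r" and u: "u \<in> cball \<beta>\<^sub>0 \<rho>" and v: "v \<in> cball \<beta>\<^sub>0 \<rho>" for n y \<rho> u v
  proof -
    have "(\<Sum>i = 1..n. log_partition \<nu> b (X i *v u) - log_partition \<nu> b (X i *v v) - mean_score (X i) \<beta>\<^sub>0 \<bullet> (u - v))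
        \<le> (\<Sum>i = 1..n. C * \<rho> * norm (u - v))"
      using X by (intro sum_mono abs_le_D1[OF linear] \<rho> u v) auto
    moreover have "neg_loglik X n y u - neg_loglik X n y v - score_deviation X \<beta>\<^sub>0 n y \<bullet> (u - v)
        = (\<Sum>i = 1..n. log_partition \<nu> b (X i *v u) - log_partition \<nu> b (X i *v v) - mean_score (X i) \<beta>\<^sub>0 \<bullet> (u - v))"
      unfolding neg_loglik_eq score sum_subtractf[symmetric]
      by (intro sum.cong refl) (simp add: inner_diff_right)
    ultimately have "neg_loglik X n y u - neg_loglik X n y v - score_deviation X \<beta>\<^sub>0 n y \<bullet> (u - v)
        \<le> real n * (C * \<rho> * norm (u - v))"
      by simp
    moreover have "score_deviation X \<beta>\<^sub>0 n y \<bullet> (u - v) \<le> norm (score_deviation X \<beta>\<^sub>0 n y) * norm (u - v)"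
      by (rule norm_cauchy_schwarz)
    ultimately show ?thesis by (simp add: algebra_simps)
  qed
  show thesis
    by (rule that[OF r(1) _ C r(2) quad]) (use \<kappa>(1) lin in \<open>simp, blast\<close>)
qed

end

section \<open>Recovery of the support\<close>

lemma tuning_pos: "lam > 0 \<Longrightarrow> n \<ge> 1 \<Longrightarrow> tuning \<gamma> lam n > 0"
  by (simp add: tuning_def)

lemma tuning_tendsto_0:
  assumes "\<gamma> < 2"
  shows "tuning \<gamma> lam \<longlonglongrightarrow> 0"
proof -
  have "(\<lambda>n. real n powr ((\<gamma> - 2) / 2)) \<longlonglongrightarrow> 0"
    by (rule tendsto_neg_powr) (use assms filterlim_real_sequentially in auto)
  then show ?thesis unfolding tuning_def by (rule tendsto_mult_left_zero)
qed

text \<open>The product is \<open>lam * real n powr ((\<gamma> - 1) / 2)\<close> for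
  \<open>n \<ge> 1\<close>, and the exponent is positive.\<close>

lemma sqrt_mult_tuning_at_top:
  assumes "1 < \<gamma>" "lam > 0"
  shows "filterlim (\<lambda>n. sqrt (real n) * tuning \<gamma> lam n) at_top sequentially"
proof -
  have "filterlim (\<lambda>n. lam * exp ((\<gamma> - 1) / 2 * ln (real n))) at_top sequentially"
    by (intro filterlim_tendsto_pos_mult_at_top[OF tendsto_const] filterlim_compose[OF exp_at_top]
        filterlim_compose[OF ln_at_top filterlim_real_sequentially]) (use assms in auto)
  then show ?thesis
  proof (rule filterlim_cong[THEN iffD1, rotated 3])
    show "\<forall>\<^sub>F n in sequentially. lam * exp ((\<gamma> - 1) / 2 * ln (real n)) = sqrt (real n) * tuning \<gamma> lam n"
      using eventually_ge_at_top[of 1]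
    proof eventually_elim
      case (elim n)
      have "sqrt (real n) * real n powr ((\<gamma> - 2) / 2) = real n powr (1 / 2 + (\<gamma> - 2) / 2)"
        using elim by (simp only: powr_add) (simp add: powr_half_sqrt)
      also have "1 / 2 + (\<gamma> - 2) / 2 = (\<gamma> - 1) / 2" by (simp add: field_simps)
      also have "real n powr \<dots> = exp ((\<gamma> - 1) / 2 * ln (real n))"
        using elim by (simp add: powr_def)
      finally show ?case by (simp add: tuning_def mult.commute mult.left_commute)
    qed
  qed auto
qed

text \<open>At the origin, where the penalty is not differentiable, continuity comes from the finite
  limit of \<open>\<eta> (L n) t / \<bar>t\<bar>\<close> in (P2).\<close>

lemma penalty_continuous:
  assumes P1: "cond_P1 \<eta> L" and P2: "cond_P2 \<eta> L" and n: "n \<ge> 1"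
  shows "continuous_on UNIV (\<eta> (L n))"
proof (intro continuous_at_imp_continuous_on ballI)
  fix t :: real
  show "isCont (\<eta> (L n)) t"
  proof (cases "t = 0")
    case False
    then have "\<eta> (L n) differentiable (at t)" using P1 n by (auto simp: cond_P1_def)
    then show ?thesis by (rule differentiable_imp_continuous_within)
  next
    case True
    have lim: "((\<lambda>t. \<eta> (L n) t / \<bar>t\<bar>) \<longlongrightarrow> L n) (at 0)" and zero: "\<eta> (L n) 0 = 0"
      using P2 n by (auto simp: cond_P2_def)
    have "((\<lambda>t. \<eta> (L n) t / \<bar>t\<bar> * \<bar>t\<bar>) \<longlongrightarrow> L n * \<bar>0\<bar>) (at 0)"
      by (intro tendsto_intros lim)
    moreover have "\<forall>\<^sub>F t in at 0. \<eta> (L n) t / \<bar>t\<bar> * \<bar>t\<bar> = \<eta> (L n) t"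
      by (auto simp: eventually_at_filter)
    ultimately have "(\<eta> (L n) \<longlongrightarrow> 0) (at 0)"
      using tendsto_cong by fastforce
    then show ?thesis using True zero by (simp add: isCont_def)
  qed
qed

text \<open>Checks the hypotheses of \<open>penalized_convex_argmin_support\<close> with
  \<open>\<sigma> = K * sqrt (real n)\<close>. The quantifier over \<open>y\<close> stands inside,
  so one \<open>n\<close> serves all outcomes with a small score.\<close>

lemma (in glm_regressors) eventually_support_recovered:
  assumes \<beta>\<^sub>0: "\<beta>\<^sub>0 \<in> B" and X: "\<forall>i\<ge>1. X i \<in> \<X>" and C2: "cond_C2 \<nu> b \<X> B X"
    and lam: "lam > 0" and gamma: "1 < \<gamma>" "\<gamma> < 2"
    and P1: "cond_P1 \<eta> (tuning \<gamma> lam)" and P2: "cond_P2 \<eta> (tuning \<gamma> lam)"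
    and P2_local: "cond_P2_local \<eta> (tuning \<gamma> lam)"
    and P3: "cond_P3 \<eta> (tuning \<gamma> lam)" and P4: "cond_P4 \<eta> (tuning \<gamma> lam)"
    and K: "K > 0"
  shows "\<forall>\<^sub>F n in sequentially. \<forall>y. norm (score_deviation X \<beta>\<^sub>0 n y) < K * sqrt (real n) \<longrightarrow>
    (let Q = penalized_objective \<nu> b (\<eta> (tuning \<gamma> lam n)) n y X in
      (\<exists>\<beta>. is_arg_min Q (\<lambda>\<beta>. \<beta> \<in> B) \<beta>) \<and>
      (\<forall>\<beta>. is_arg_min Q (\<lambda>\<beta>. \<beta> \<in> B) \<beta> \<longrightarrow> {j. \<beta> $ j \<noteq> 0} = {j. \<beta>\<^sub>0 $ j \<noteq> 0}))"
proof -
  let ?L = "tuning \<gamma> lam"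
  obtain r\<^sub>0 c C where r\<^sub>0: "r\<^sub>0 > 0" and c: "c > 0" and C: "C \<ge> 0" and sub: "cball \<beta>\<^sub>0 r\<^sub>0 \<subseteq> B"
    and quad: "\<forall>\<^sub>F n in sequentially. \<forall>y. \<forall>\<beta> \<in> cball \<beta>\<^sub>0 r\<^sub>0. neg_loglik X n y \<beta> \<ge>
       neg_loglik X n y \<beta>\<^sub>0 + score_deviation X \<beta>\<^sub>0 n y \<bullet> (\<beta> - \<beta>\<^sub>0) + real n * c * (norm (\<beta> - \<beta>\<^sub>0))\<^sup>2"
    and lin: "\<forall>n y. \<forall>\<rho>\<le>r\<^sub>0. \<forall>u \<in> cball \<beta>\<^sub>0 \<rho>. \<forall>v \<in> cball \<beta>\<^sub>0 \<rho>.
       neg_loglik X n y u - neg_loglik X n y v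
         \<le> (norm (score_deviation X \<beta>\<^sub>0 n y) + real n * C * \<rho>) * norm (u - v)"
    by (rule neg_loglik_bounds[OF \<beta>\<^sub>0 X C2], rule that)
  \<comment> \<open>Half the smallest nonzero true coefficient in absolute value, capped at 1/2; the
    inserted 1 keeps the minimum defined when all coefficients vanish. With \<open>r \<le> m\<close>
    the support condition \<open>m + r\<close> is met.\<close>
  define m where "m = Min (insert 1 ((\<lambda>j. \<bar>\<beta>\<^sub>0 $ j\<bar>) ` {j. \<beta>\<^sub>0 $ j \<noteq> 0})) / 2"
  have m: "m > 0" by (auto simp: m_def)
  have m_le: "2 * m \<le> \<bar>\<beta>\<^sub>0 $ j\<bar>" if "\<beta>\<^sub>0 $ j \<noteq> 0" for j
    using that by (auto simp: m_def intro!: Min_le)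
  define r where "r = min r\<^sub>0 m"
  have r: "r > 0" "r \<le> r\<^sub>0" "r \<le> m" using r\<^sub>0 m by (auto simp: r_def)
  obtain \<tau> where \<tau>: "\<tau> > 0" and flat: "\<And>n t. n \<ge> 1 \<Longrightarrow> \<bar>t\<bar> \<ge> \<tau> * ?L n \<Longrightarrow> deriv (\<eta> (?L n)) t = 0"
    using P4 unfolding cond_P4_def by blast
  have "(\<lambda>n. \<tau> * ?L n) \<longlonglongrightarrow> 0"
    by (rule tendsto_mult_right_zero[OF tuning_tendsto_0[OF gamma(2)]])
  then have ev_flat: "\<forall>\<^sub>F n in sequentially. \<tau> * ?L n < m"
    by (rule order_tendstoD(2)) (rule m)
  \<comment> \<open>The condition \<open>outer\<close> divided by \<open>n\<close>.\<close>
  have "(\<lambda>n. K * r / sqrt (real n) + (\<Sum>j\<in>UNIV. \<eta> (?L n) (\<beta>\<^sub>0 $ j))) \<longlonglongrightarrow> 0 + (\<Sum>j\<in>(UNIV :: 'p set). 0)"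
  proof (intro tendsto_add tendsto_sum)
    show "(\<lambda>n. K * r / sqrt (real n)) \<longlonglongrightarrow> 0"
      by (intro tendsto_divide_0[OF tendsto_const] filterlim_at_top_imp_at_infinity
          filterlim_compose[OF sqrt_at_top filterlim_real_sequentially])
    show "(\<lambda>n. \<eta> (?L n) (\<beta>\<^sub>0 $ j)) \<longlonglongrightarrow> 0" for j
      using P3 by (simp add: cond_P3_def)
  qed
  then have ev_outer: "\<forall>\<^sub>F n in sequentially. K * r / sqrt (real n) + (\<Sum>j\<in>UNIV. \<eta> (?L n) (\<beta>\<^sub>0 $ j)) < c * r\<^sup>2"
    by (rule order_tendstoD(2)) (use c r in simp)
  \<comment> \<open>Condition \<open>inner\<close> asks that \<open>n * L n / 2\<close> exceed the
    slope \<open>(K + C * K / c) * sqrt n\<close>; dividing by \<open>sqrt n / 2\<close> gives this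
    form. The localization radius \<open>\<sigma> / (n * c)\<close> becomes
    \<open>(K / c) / sqrt n\<close> in \<open>ev_local\<close>.\<close>
  have ev_slope: "\<forall>\<^sub>F n in sequentially. 2 * (K + C * K / c) \<le> sqrt (real n) * ?L n"
    using sqrt_mult_tuning_at_top[OF gamma(1) lam] by (simp add: filterlim_at_top)
  have ev_local: "\<forall>\<^sub>F n in sequentially. \<forall>t. t \<noteq> 0 \<longrightarrow> \<bar>t\<bar> \<le> (K / c) / sqrt (real n) \<longrightarrow>
      ?L n / 2 * \<bar>t\<bar> < \<eta> (?L n) t"
    by (rule cond_P2_local_lower_bound[OF P2_local tuning_pos[OF lam]])
  show ?thesis
    using eventually_ge_at_top[of 1] quad ev_flat ev_outer ev_slope ev_local
  proof eventually_elim
    case (elim n)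
    note n = elim(1) and quad_n = elim(2) and flat_n = elim(3) and outer_n = elim(4)
      and slope_n = elim(5) and local_n = elim(6)
    define h where "h = \<eta> (?L n)"
    have sqrt_n: "sqrt (real n) > 0" "real n = sqrt (real n) * sqrt (real n)" using n by auto
    have diff: "\<And>t. t \<noteq> 0 \<Longrightarrow> h differentiable (at t)" and even: "\<And>t. h (- t) = h t"
      and mono: "\<And>s t. \<bar>s\<bar> \<le> \<bar>t\<bar> \<Longrightarrow> h s \<le> h t"
      using P1 n by (auto simp: cond_P1_def h_def)
    have h0: "h 0 = 0" using P2 n by (auto simp: cond_P2_def h_def)
    have h_cont: "continuous_on UNIV h" unfolding h_def by (rule penalty_continuous[OF P1 P2 n])
    have h_nonneg: "h t \<ge> 0" for t using mono[of 0 t] h0 by simp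
    have h_zero: "deriv h t = 0" if "m \<le> \<bar>t\<bar>" for t
      using flat[OF n, of t] flat_n that by (simp add: h_def)
    have h_flat: "h t = h t'" if "m \<le> \<bar>t\<bar>" "m \<le> \<bar>t'\<bar>" for t t'
      using even_mono_deriv_zero_imp_flat[OF diff even h_zero m] that by metis
    have support: "m + r \<le> \<bar>\<beta>\<^sub>0 $ j\<bar>" if "\<beta>\<^sub>0 $ j \<noteq> 0" for j
      using m_le[OF that] r by linarith
    have outer: "K * sqrt (real n) * r + real n * (\<Sum>j\<in>UNIV. h (\<beta>\<^sub>0 $ j)) < real n * c * r\<^sup>2"
    proof -
      have "real n * (K * r / sqrt (real n)) = K * sqrt (real n) * r"
        using sqrt_n by (simp add: field_simps)
      moreover have "real n * (K * r / sqrt (real n) + (\<Sum>j\<in>UNIV. h (\<beta>\<^sub>0 $ j))) < real n * (c * r\<^sup>2)"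
        unfolding h_def using n outer_n by (intro mult_strict_left_mono) auto
      ultimately show ?thesis by (simp add: distrib_left mult.assoc)
    qed
    have inner: "(K * sqrt (real n) + C * (K * sqrt (real n)) / c) * \<bar>t\<bar> < real n * h t"
      if t: "t \<noteq> 0" "\<bar>t\<bar> \<le> K * sqrt (real n) / (real n * c)" for t
    proof -
      have "K * sqrt (real n) / (real n * c) = (K / c) / sqrt (real n)"
        using sqrt_n c n by (simp add: field_simps)
      then have "?L n / 2 * \<bar>t\<bar> < h t" using local_n t unfolding h_def by simp
      then have less: "real n * (?L n / 2 * \<bar>t\<bar>) < real n * h t" using n by simp
      have "(K * sqrt (real n) + C * (K * sqrt (real n)) / c) * \<bar>t\<bar>
          = sqrt (real n) * (2 * (K + C * K / c)) * (\<bar>t\<bar> / 2)"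
        using c by (simp add: field_simps)
      also have "\<dots> \<le> sqrt (real n) * (sqrt (real n) * ?L n) * (\<bar>t\<bar> / 2)"
        by (intro mult_right_mono mult_left_mono slope_n) auto
      also have "\<dots> = real n * (?L n / 2 * \<bar>t\<bar>)" by simp
      finally show ?thesis using less by linarith
    qed
    show ?case
    proof (intro allI impI)
      fix y assume score: "norm (score_deviation X \<beta>\<^sub>0 n y) < K * sqrt (real n)"
      have Q: "penalized_objective \<nu> b h n y X
          = (\<lambda>\<beta>. neg_loglik X n y \<beta> + real n * (\<Sum>j\<in>UNIV. h (\<beta> $ j)))"
        by (simp add: penalized_objective_def fun_eq_iff)
      have quad': "neg_loglik X n y \<beta> \<ge>
         neg_loglik X n y \<beta>\<^sub>0 + score_deviation X \<beta>\<^sub>0 n y \<bullet> (\<beta> - \<beta>\<^sub>0) + real n * c * (norm (\<beta> - \<beta>\<^sub>0))\<^sup>2"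
        if "\<beta> \<in> cball \<beta>\<^sub>0 r" for \<beta>
        using quad_n that r(2) by auto
      have lin': "neg_loglik X n y u - neg_loglik X n y v
         \<le> (norm (score_deviation X \<beta>\<^sub>0 n y) + real n * C * \<rho>) * norm (u - v)"
        if "\<rho> \<le> r" "u \<in> cball \<beta>\<^sub>0 \<rho>" "v \<in> cball \<beta>\<^sub>0 \<rho>" for \<rho> u v
        by (rule lin[rule_format]) (use that r(2) in auto)
      have ball: "cball \<beta>\<^sub>0 r \<subseteq> B" using r(2) sub by auto
      note core = penalized_convex_argmin_support[where f = "neg_loglik X n y" and h = h and n = "real n"
          and \<sigma> = "K * sqrt (real n)", OF open_B convex_on_neg_loglik[OF X] _ c C r(1) m ball quad' lin'
          less_imp_le[OF score] h_cont h0 h_nonneg h_flat support outer inner, folded Q, unfolded h_def]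
      show "let Q = penalized_objective \<nu> b (\<eta> (?L n)) n y X in
          (\<exists>\<beta>. is_arg_min Q (\<lambda>\<beta>. \<beta> \<in> B) \<beta>) \<and>
          (\<forall>\<beta>. is_arg_min Q (\<lambda>\<beta>. \<beta> \<in> B) \<beta> \<longrightarrow> {j. \<beta> $ j \<noteq> 0} = {j. \<beta>\<^sub>0 $ j \<noteq> 0})"
        unfolding Let_def using core n by simp
    qed
  qed
qed

theorem theorem3:
  fixes M :: "'w measure"
    and \<nu> :: "(real ^ 'r) measure" and b :: "real ^ 'r \<Rightarrow> real"
    and \<X> :: "(real ^ 'p ^ 'r) set" and B :: "(real ^ 'p) set"
    and X :: "nat \<Rightarrow> real ^ 'p ^ 'r" and Y :: "nat \<Rightarrow> 'w \<Rightarrow> real ^ 'r"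
    and \<beta>star :: "real ^ 'p"
    and \<eta> :: "real \<Rightarrow> real \<Rightarrow> real" and lam \<gamma>\<^sub>0 :: real
    and \<beta>hat :: "nat \<Rightarrow> 'w \<Rightarrow> real ^ 'p"
  assumes prob: "prob_space M"
    and family: "natural_exponential_family \<nu> b"
    and B: "open B" "convex B" "\<beta>star \<in> B"
    and X: "\<forall>i\<ge>1. X i \<in> \<X>"
    and indep: "prob_space.indep_vars M (\<lambda>_. borel) Y {1..}"
    and distr: "\<forall>i\<ge>1. distributed M \<nu> (Y i) (\<lambda>y. ennreal (nef_density \<nu> b (X i *v \<beta>star) y))"
    and C1: "cond_C1 \<nu> b \<X> B"
    and C2: "cond_C2 \<nu> b \<X> B X"
    and lam: "lam > 0" and gamma: "1 < \<gamma>\<^sub>0" "\<gamma>\<^sub>0 < 2"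
    and P1: "cond_P1 \<eta> (tuning \<gamma>\<^sub>0 lam)"
    and P2: "cond_P2 \<eta> (tuning \<gamma>\<^sub>0 lam)"
    and P2_local: "cond_P2_local \<eta> (tuning \<gamma>\<^sub>0 lam)"
    and P3: "cond_P3 \<eta> (tuning \<gamma>\<^sub>0 lam)"
    and P4: "cond_P4 \<eta> (tuning \<gamma>\<^sub>0 lam)"
    and P5: "cond_P5 \<eta> (tuning \<gamma>\<^sub>0 lam)"
    and est: "\<forall>n\<ge>1. penalized_mle M \<nu> b (\<eta> (tuning \<gamma>\<^sub>0 lam n)) B n Y X (\<beta>hat n)"
  shows "(\<lambda>n. measure M {\<omega> \<in> space M. {j. \<beta>hat n \<omega> $ j \<noteq> 0} = {j. \<beta>star $ j \<noteq> 0}})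
           \<longlonglongrightarrow> 1"
proof -
  interpret prob_space M by (rule prob)
  interpret glm_regressors \<nu> b \<X> B by standard (rule family B C1)+
  define E where "E n = {\<omega> \<in> space M. {j. \<beta>hat n \<omega> $ j \<noteq> 0} = {j. \<beta>star $ j \<noteq> 0}}" for n
  define bad where "bad K n = {\<omega> \<in> space M. norm (score_deviation X \<beta>star n (\<lambda>i. Y i \<omega>)) \<ge> K * sqrt (real n)}" for K n
  obtain V where V: "V \<ge> 0" and tail: "\<And>n K. n \<ge> 1 \<Longrightarrow> K > 0 \<Longrightarrow> prob (bad K n) \<le> V / K\<^sup>2"
    using score_deviation_tail[OF prob B(3) X indep distr] unfolding bad_def by blast
  have bad_sets: "bad K n \<in> sets M" for K n
  proof -
    have [measurable]: "(\<lambda>\<omega>. score_deviation X \<beta>star n (\<lambda>i. Y i \<omega>)) \<in> borel_measurable M"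
      using indep by (intro borel_measurable_score_deviation) (auto simp: indep_vars_def)
    show ?thesis unfolding bad_def by measurable
  qed
  have E_sets: "E n \<in> sets M" if "n \<ge> 1" for n
  proof -
    have est_meas: "\<beta>hat n \<in> borel_measurable M" using est that by (auto simp: penalized_mle_def)
    have [measurable]: "(\<lambda>\<omega>. \<beta>hat n \<omega> $ j) \<in> borel_measurable M" for j
      by (rule measurable_compose[OF est_meas]) (intro borel_measurable_continuous_onI continuous_intros)
    have "E n = {\<omega> \<in> space M. \<forall>j. (\<beta>hat n \<omega> $ j \<noteq> 0) = (\<beta>star $ j \<noteq> 0)}"
      unfolding E_def by blast
    also have "\<dots> \<in> sets M" by measurable
    finally show ?thesis .
  qed
  \<comment> \<open>Off \<open>bad K n\<close> a minimizer exists, so the estimator is one; its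
    arbitrary value where no minimizer exists can matter only inside \<open>bad K n\<close>.\<close>
  have cover: "\<forall>\<^sub>F n in sequentially. space M - E n \<subseteq> bad K n" if "K > 0" for K
    using eventually_support_recovered[OF B(3) X C2 lam gamma P1 P2 P2_local P3 P4 that]
      eventually_ge_at_top[of 1]
  proof eventually_elim
    case (elim n)
    show ?case
    proof (rule subsetI, rule ccontr)
      fix \<omega> assume \<omega>: "\<omega> \<in> space M - E n" and "\<omega> \<notin> bad K n"
      then have score: "norm (score_deviation X \<beta>star n (\<lambda>i. Y i \<omega>)) < K * sqrt (real n)"
        by (auto simp: bad_def)
      have "penalized_mle M \<nu> b (\<eta> (tuning \<gamma>\<^sub>0 lam n)) B n Y X (\<beta>hat n)" using est elim(2) by blast
      with elim(1)[rule_format, OF score] \<omega> have "\<omega> \<in> E n"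
        unfolding penalized_mle_def Let_def E_def by blast
      then show False using \<omega> by blast
    qed
  qed
  have "(\<lambda>n. prob (E n)) \<longlonglongrightarrow> 1"
  proof (rule LIMSEQ_I)
    fix e :: real assume e: "e > 0"
    \<comment> \<open>Makes the tail bound \<open>V / K\<^sup>2\<close> equal to
      \<open>e * V / (V + 1) < e\<close>; the added 1 keeps \<open>K\<close> positive when
      \<open>V = 0\<close>. \<open>K\<close> is fixed by \<open>e\<close> before \<open>n\<close>
      grows, as the threshold in \<open>cover\<close> depends on it.\<close>
    define K where "K = sqrt ((V + 1) / e)"
    have K: "K > 0" "K\<^sup>2 = (V + 1) / e" using V e by (auto simp: K_def)
    have small: "V / K\<^sup>2 < e" using V e by (simp add: K(2) field_simps)
    have "\<forall>\<^sub>F n in sequentially. norm (prob (E n) - 1) < e"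
      using cover[OF K(1)] eventually_ge_at_top[of 1]
    proof eventually_elim
      case (elim n)
      have "1 - prob (E n) = prob (space M - E n)" by (rule prob_compl[OF E_sets[OF elim(2)], symmetric])
      also have "\<dots> \<le> prob (bad K n)" by (rule finite_measure_mono[OF elim(1) bad_sets])
      also have "\<dots> \<le> V / K\<^sup>2" by (rule tail[OF elim(2) K(1)])
      finally show ?case using small prob_le_1[of "E n"] by simp
    qed
    then show "\<exists>n\<^sub>0. \<forall>n\<ge>n\<^sub>0. norm (prob (E n) - 1) < e" by (simp add: eventually_sequentially)
  qed
  then show ?thesis by (simp add: E_def)
qed

end
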